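(* Let $G$ be a finite simple graph with $n\ge1$ vertices and let $\lambda_1(G)$ be the largest eigenvalue of its adjacency matrix. Let $\xi(t)$ be the continuous-time Markov chain with parameters $\alpha,\beta\in\mathbb{R}$ and graph $G$ described in the context. If $\alpha<0$ and $\alpha+\beta\lambda_1(G)=0$, then $\xi(t)$ is transient and non-explosive.
   Context: $G$ is a finite undirected graph, not necessarily connected, with vertices $1,\dots,n$ and without self-loops or multiple edges; $A$ is its adjacency matrix, and $i\sim j$ means that $i$ and $j$ are adjacent. $\mathbb{Z}_+=\{0,1,2,\dots\}$ and $\mathbf e_i$ is the $i$-th unit vector. The chain $\xi(t)\in\mathbb{Z}_+^n$ has transition rates $$q_{\xi,\xi+\mathbf e_i}=e^{\alpha\xi_i+\beta(A\xi)_i}=e^{\alpha\xi_i+\beta\sum_{j:\,j\sim i}\xi_j},\qquad q_{\xi,\xi-\mathbf e_i}=1 \ \text{ if } \xi_i>0,$$ and all other rates are $0$. The chain is non-explosive if almost surely it makes only finitely many jumps in any finite time interval. *)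

theory Defs
  imports "HOL-Probability.Probability"
begin

section \<open>Graphs and the spectrum of the adjacency matrix\<close>

text \<open>The vertex set is the finite type \<open>'n\<close>; adjacency is a relation on it.\<close>

definition simple_graph :: "('n \<Rightarrow> 'n \<Rightarrow> bool) \<Rightarrow> bool" where
  "simple_graph E \<longleftrightarrow> symp E \<and> irreflp E"

definition adjacency_matrix :: "('n::finite \<Rightarrow> 'n \<Rightarrow> bool) \<Rightarrow> real^'n^'n" where
  "adjacency_matrix E = (\<chi> i j. if E i j then 1 else 0)"

definition eigenvalue :: "real^'n^'n \<Rightarrow> real \<Rightarrow> bool" where
  "eigenvalue A l \<longleftrightarrow> (\<exists>v. v \<noteq> 0 \<and> A *v v = l *s v)"

text \<open>Only real eigenvalues are considered, which loses nothing for a symmetric matrix; for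
  such a matrix the set below is finite and nonempty, so that \<^const>\<open>Max\<close> is meaningful.\<close>

definition largest_eigenvalue :: "real^'n^'n \<Rightarrow> real" where
  "largest_eigenvalue A = Max {l. eigenvalue A l}"


section \<open>Continuous-time Markov chains with given transition rates\<close>

text \<open>Here \<open>q x y\<close> for \<open>x \<noteq> y\<close> is the rate of the transition from \<open>x\<close> to \<open>y\<close>; diagonal values of
  \<open>q\<close> are ignored. Every state is supposed to have a positive finite exit rate, i.e. there are no
  absorbing states.\<close>

definition exit_rate :: "('s \<Rightarrow> 's \<Rightarrow> real) \<Rightarrow> 's \<Rightarrow> real" where
  "exit_rate q x = (\<Sum>\<^sub>\<infinity>y\<in>-{x}. q x y)"

definition jump_prob :: "('s \<Rightarrow> 's \<Rightarrow> real) \<Rightarrow> 's \<Rightarrow> 's \<Rightarrow> real" where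
  "jump_prob q x y = (if y = x then 0 else q x y / exit_rate q x)"

text \<open>
  The chain with rates \<open>q\<close>, on an arbitrary probability space and with an arbitrary initial
  distribution, in terms of its embedded jump chain \<open>Y\<close> and its holding times \<open>S\<close>. The law
  says: \<open>Y\<close> is a discrete-time Markov chain with transition matrix \<open>jump_prob q\<close>, and, given
  \<open>Y 0, Y 1, \<dots>\<close>, the \<open>S k\<close> are independent, exponential with parameter \<open>exit_rate q (Y k)\<close>.
\<close>

locale ctmc = prob_space M
  for M :: "'w measure" and q :: "'s::countable \<Rightarrow> 's \<Rightarrow> real"
    and Y :: "nat \<Rightarrow> 'w \<Rightarrow> 's" and S :: "nat \<Rightarrow> 'w \<Rightarrow> real" +
  assumes measurable_jump_chain: "\<And>k. Y k \<in> measurable M (count_space UNIV)"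
    and measurable_holding_time: "\<And>k. S k \<in> borel_measurable M"
    and law: "\<And>(n::nat) (x::nat \<Rightarrow> 's) (t::nat \<Rightarrow> real). (\<And>k. k < n \<Longrightarrow> 0 \<le> t k) \<Longrightarrow>
      prob {\<omega> \<in> space M. (\<forall>k\<le>n. Y k \<omega> = x k) \<and> (\<forall>k<n. t k < S k \<omega>)} =
      prob {\<omega> \<in> space M. Y 0 \<omega> = x 0} *
        (\<Prod>k<n. exp (- exit_rate q (x k) * t k) * jump_prob q (x k) (x (Suc k)))"

text \<open>The time of the \<open>k\<close>-th jump, with \<open>jump_time S 0 \<omega> = 0\<close>.\<close>

definition jump_time :: "(nat \<Rightarrow> 'w \<Rightarrow> real) \<Rightarrow> nat \<Rightarrow> 'w \<Rightarrow> real" where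
  "jump_time S k \<omega> = (\<Sum>i<k. S i \<omega>)"

text \<open>The state at time \<open>t \<ge> 0\<close>: it is \<open>Y k\<close> for \<open>jump_time S k \<le> t < jump_time S (Suc k)\<close>. From the
  explosion time on (if there is one) the chain is in the cemetery \<^const>\<open>None\<close>.\<close>

definition chain_at ::
    "(nat \<Rightarrow> 'w \<Rightarrow> 's) \<Rightarrow> (nat \<Rightarrow> 'w \<Rightarrow> real) \<Rightarrow> real \<Rightarrow> 'w \<Rightarrow> 's option" where
  "chain_at Y S t \<omega> =
    (if \<exists>k. t < jump_time S (Suc k) \<omega>
     then Some (Y (LEAST k. t < jump_time S (Suc k) \<omega>) \<omega>) else None)"

text \<open>Every state is transient: almost surely the set of times spent in it is bounded.\<close>

definition transient :: "'w measure \<Rightarrow> (real \<Rightarrow> 'w \<Rightarrow> 's option) \<Rightarrow> bool" where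
  "transient M X \<longleftrightarrow> (\<forall>x. AE \<omega> in M. bdd_above {t. 0 \<le> t \<and> X t \<omega> = Some x})"

definition non_explosive :: "'w measure \<Rightarrow> (nat \<Rightarrow> 'w \<Rightarrow> real) \<Rightarrow> bool" where
  "non_explosive M S \<longleftrightarrow> (AE \<omega> in M. \<forall>t. finite {k. jump_time S k \<omega> \<le> t})"


section \<open>The interacting birth-and-death chain on a graph\<close>

text \<open>The target \<open>\<eta>\<close> equals at most one of the states \<open>\<xi> + axis i 1\<close> and \<open>\<xi> - axis i 1\<close> (with
  \<open>\<xi> $ i > 0\<close>), so at most one summand below is nonzero.\<close>

definition interaction_rate ::
    "real \<Rightarrow> real \<Rightarrow> ('n::finite \<Rightarrow> 'n \<Rightarrow> bool) \<Rightarrow> nat^'n \<Rightarrow> nat^'n \<Rightarrow> real" where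
  "interaction_rate \<alpha> \<beta> E \<xi> \<eta> =
    (\<Sum>i\<in>UNIV. if \<eta> = \<xi> + axis i 1
       then exp (\<alpha> * real (\<xi> $ i) + \<beta> * (adjacency_matrix E *v (\<chi> j. real (\<xi> $ j))) $ i)
       else 0) +
    (\<Sum>i\<in>UNIV. if \<xi> $ i > 0 \<and> \<eta> = \<xi> - axis i 1 then 1 else 0)"

end

theory Submission
  imports Defs
begin

text \<open>
  Let \<open>A\<close> be the adjacency matrix, \<open>B = \<alpha> I + \<beta> A\<close> and \<open>u = B \<xi>\<close>, so that vertex \<open>i\<close> has birth rate \<open>exp u\<^sub>i\<close>
  and, when occupied, death rate \<open>1\<close>. By Perron's argument the top eigenvalue of \<open>A\<close> has a nonnegative eigenvector \<open>v\<close>;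
  the critical relation says that \<open>B\<close> is negative semidefinite and \<open>B v = 0\<close>
  (\<open>interaction_matrix_degenerate\<close>). Each half of the theorem then follows from a suitable function on the
  state space and the sign of its drift, that is, of its image under the generator.

  Non-explosion: take the energy \<open>U = - (\<xi> \<bullet> B \<xi>) / 2 \<ge> 0\<close>. With \<open>c = - \<alpha> / 2\<close>, a birth at \<open>i\<close> changes it by
  \<open>c - u\<^sub>i\<close> and a death by \<open>c + u\<^sub>i\<close>. A birth rate is large only if \<open>u\<^sub>i\<close> is, and then births lower the energy; so the
  drift of \<open>U\<close> is bounded above. Since \<open>u\<^sub>i\<^sup>2 \<le> 4 c U\<close> by Cauchy-Schwarz, the rates are bounded where \<open>U\<close> is, and
  \<open>non_explosive_if_drift_le\<close> applies.

  Transience: the drift of \<open>v \<bullet> \<xi>\<close> is at least \<open>\<Sum>i. v\<^sub>i (exp u\<^sub>i - 1) \<ge> v \<bullet> u = 0\<close>. It is bounded away from \<open>0\<close>,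
  relative to the jump rates, except near balance, where all \<open>u\<^sub>i\<close> with \<open>v\<^sub>i > 0\<close> are small. Hence \<open>exp (- d (v \<bullet> \<xi>))\<close> has
  negative drift away from balance, and near balance its drift is of second order in \<open>d\<close>. A jump changes
  \<open>u\<^sub>i\<close> at its own vertex by \<open>\<plusminus> \<alpha>\<close>, so it leads out of a small neighbourhood of balance; enlarging the function there by
  a factor \<open>1 + 2 d\<^sup>2\<close> therefore makes the drift strictly negative at every state. This bounds the expected number of
  visits to any state (\<open>transient_if_drift_neg\<close>).

  Both criteria rest on \<open>start_expectation\<close>: the expectation of \<open>exp (- l (S 0 + \<dots> + S (n - 1))) h (Y n)\<close>
  is obtained by applying to \<open>h\<close> the \<open>n\<close>-th power of the kernel \<open>q x y / (exit_rate q x + l)\<close>. Once this is known, what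
  remains are inequalities between functions on the state space.
\<close>

section \<open>Laplace transforms of exponential variables\<close>

text \<open>The indicator of \<open>0 < s\<close> is built in because the law of the chain only speaks about the events
  \<open>t < S k\<close> with \<open>t \<ge> 0\<close>: that the holding times are positive has to come out of it.\<close>

definition discount :: "real \<Rightarrow> real \<Rightarrow> ennreal" where
  "discount l s = (if 0 < s then ennreal (exp (- l * s)) else 0)"

lemma measurable_discount [measurable]: "discount l \<in> borel_measurable borel"
  unfolding discount_def by measurable

lemma discount_le_1: "0 \<le> l \<Longrightarrow> discount l s \<le> 1"
  by (auto simp: discount_def ennreal_le_1)

lemma nn_integral_exp_atLeast:
  fixes c k s :: real
  assumes "0 < c" "0 \<le> k"
  shows "(\<integral>\<^sup>+t. ennreal (k * exp (- c * t)) * indicator {s..} t \<partial>lborel) = ennreal (k / c * exp (- c * s))"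
proof -
  have "(\<integral>\<^sup>+t. ennreal (k * exp (- c * t)) * indicator {s..} t \<partial>lborel)
      = ennreal (0 - (- k / c * exp (- c * s)))"
  proof (rule nn_integral_FTC_atLeast)
    show "((\<lambda>t. - k / c * exp (- c * t)) has_real_derivative k * exp (- c * t)) (at t)" for t
      using assms by (auto intro!: derivative_eq_intros)
    have "((\<lambda>t. exp (- c * t)) \<longlongrightarrow> 0) at_top"
      using assms by (intro filterlim_compose[OF exp_at_bot] filterlim_tendsto_neg_mult_at_bot[OF tendsto_const] filterlim_ident) auto
    from tendsto_mult_left[OF this, of "- k / c"]
    show "((\<lambda>t. - k / c * exp (- c * t)) \<longlongrightarrow> 0) at_top" by simp
  qed (use assms in auto)
  then show ?thesis by simp
qed

text \<open>Writes \<open>exp (- l s)\<close> as a mixture of the events \<open>t < s\<close>, whose probabilities are known. It has the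
  form of a sum because subtraction is badly behaved on \<^typ>\<open>ennreal\<close>.\<close>

lemma discount_eq_nn_integral:
  assumes "0 < l"
  shows "discount l s + (\<integral>\<^sup>+t. ennreal (l * exp (- l * t)) * indicator {0..} t * indicator {t<..} s \<partial>lborel)
    = indicator {0<..} s"
proof (cases "0 < s")
  case True
  have "discount l s = (\<integral>\<^sup>+t. ennreal (l * exp (- l * t)) * indicator {s..} t \<partial>lborel)"
    using True assms by (subst nn_integral_exp_atLeast) (auto simp: discount_def)
  then have "discount l s + (\<integral>\<^sup>+t. ennreal (l * exp (- l * t)) * indicator {0..} t * indicator {t<..} s \<partial>lborel)
     = (\<integral>\<^sup>+t. ennreal (l * exp (- l * t)) * indicator {s..} t +
          ennreal (l * exp (- l * t)) * indicator {0..} t * indicator {t<..} s \<partial>lborel)"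
    by (subst nn_integral_add) (auto simp: indicator_def cong: if_cong)
  also have "\<dots> = (\<integral>\<^sup>+t. ennreal (l * exp (- l * t)) * indicator {0..} t \<partial>lborel)"
    using True by (intro nn_integral_cong) (auto simp: indicator_def)
  also have "\<dots> = 1"
    using assms by (subst nn_integral_exp_atLeast) auto
  finally show ?thesis using True by simp
next
  case False
  have "(\<integral>\<^sup>+t. ennreal (l * exp (- l * t)) * indicator {0..} t * indicator {t<..} s \<partial>lborel) = (\<integral>\<^sup>+t. 0 \<partial>(lborel :: real measure))"
    using False by (intro nn_integral_cong) (auto simp: indicator_def)
  then show ?thesis using False by (simp add: discount_def)
qed

text \<open>The Laplace transform of an exponential variable, read off its tail by Fubini. The measure \<open>N\<close> is
  arbitrary and of arbitrary mass \<open>a\<close>, so that \<open>N\<close> can carry a density coming from the other holding times.\<close>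

lemma nn_integral_discount_exponential:
  assumes fin: "finite_measure N" and S [measurable]: "S \<in> borel_measurable N"
    and "0 \<le> l" "0 < q"
    and tail: "\<And>t. 0 \<le> t \<Longrightarrow>
      emeasure N {\<omega> \<in> space N. t < S \<omega>} = a * ennreal (exp (- q * t))"
  shows "(\<integral>\<^sup>+\<omega>. discount l (S \<omega>) \<partial>N) = a * ennreal (q / (q + l))"
proof -
  interpret finite_measure N by fact
  interpret pair_sigma_finite N lborel ..
  have pos: "emeasure N {\<omega> \<in> space N. 0 < S \<omega>} = a" using tail[of 0] by simp
  then have a: "a \<noteq> \<top>" using emeasure_finite by metis
  have ind: "indicator {t<..} (S \<omega>) = (indicator {\<omega> \<in> space N. t < S \<omega>} \<omega> :: ennreal)"
    if "\<omega> \<in> space N" for t \<omega> using that by (auto simp: indicator_def)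
  show ?thesis
  proof (cases "l = 0")
    case True
    have "(\<integral>\<^sup>+\<omega>. discount l (S \<omega>) \<partial>N) = (\<integral>\<^sup>+\<omega>. indicator {\<omega> \<in> space N. 0 < S \<omega>} \<omega> \<partial>N)"
      using True by (intro nn_integral_cong) (auto simp: discount_def indicator_def)
    then show ?thesis using True \<open>0 < q\<close> pos by simp
  next
    case False
    with \<open>0 \<le> l\<close> have l: "0 < l" by simp
    let ?g = "\<lambda>t. ennreal (l * exp (- l * t)) * indicator {0..} t"
    have "(\<integral>\<^sup>+\<omega>. discount l (S \<omega>) \<partial>N) + (\<integral>\<^sup>+\<omega>. (\<integral>\<^sup>+t. ?g t * indicator {t<..} (S \<omega>) \<partial>lborel) \<partial>N)
        = (\<integral>\<^sup>+\<omega>. discount l (S \<omega>) + (\<integral>\<^sup>+t. ?g t * indicator {t<..} (S \<omega>) \<partial>lborel) \<partial>N)"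
      by (intro nn_integral_add[symmetric]) (auto simp: indicator_def cong: if_cong)
    also have "\<dots> = (\<integral>\<^sup>+\<omega>. indicator {\<omega> \<in> space N. 0 < S \<omega>} \<omega> \<partial>N)"
      by (intro nn_integral_cong) (subst discount_eq_nn_integral[OF l], simp add: ind)
    also have "\<dots> = a" using pos by simp
    also have "(\<integral>\<^sup>+\<omega>. (\<integral>\<^sup>+t. ?g t * indicator {t<..} (S \<omega>) \<partial>lborel) \<partial>N)
        = (\<integral>\<^sup>+t. (\<integral>\<^sup>+\<omega>. ?g t * indicator {t<..} (S \<omega>) \<partial>N) \<partial>lborel)"
      by (intro Fubini'[symmetric]) (auto simp: indicator_def cong: if_cong)
    also have "\<dots> = (\<integral>\<^sup>+t. a * (ennreal (l * exp (- (q + l) * t)) * indicator {0..} t) \<partial>lborel)"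
    proof (intro nn_integral_cong)
      fix t :: real
      have "(\<integral>\<^sup>+\<omega>. ?g t * indicator {t<..} (S \<omega>) \<partial>N)
          = (\<integral>\<^sup>+\<omega>. ?g t * indicator {\<omega> \<in> space N. t < S \<omega>} \<omega> \<partial>N)"
        by (intro nn_integral_cong) (simp only: ind)
      also have "\<dots> = ?g t * emeasure N {\<omega> \<in> space N. t < S \<omega>}"
        by (subst nn_integral_cmult_indicator) auto
      also have "\<dots> = a * (ennreal (l * exp (- (q + l) * t)) * indicator {0..} t)"
      proof (cases "0 \<le> t")
        case True
        have h: "ennreal (l * exp (- l * t)) * ennreal (exp (- q * t)) = ennreal (l * exp (- (q + l) * t))"
          using l by (subst ennreal_mult[symmetric]) (auto simp: mult_exp_exp algebra_simps)
        have "?g t * emeasure N {\<omega> \<in> space N. t < S \<omega>}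
            = a * (ennreal (l * exp (- l * t)) * ennreal (exp (- q * t)))"
          using True tail[OF True] by (simp add: mult_ac)
        then show ?thesis using True unfolding h by simp
      qed simp
      finally show "(\<integral>\<^sup>+\<omega>. ?g t * indicator {t<..} (S \<omega>) \<partial>N) = \<dots>" .
    qed
    also have "\<dots> = a * ennreal (l / (q + l))"
      using l \<open>0 < q\<close> nn_integral_exp_atLeast[of "q + l" l 0] by (subst nn_integral_cmult) auto
    finally have eq: "(\<integral>\<^sup>+\<omega>. discount l (S \<omega>) \<partial>N) + a * ennreal (l / (q + l)) = a" .
    have "q / (q + l) + l / (q + l) = 1"
      using l \<open>0 < q\<close> by (simp add: add_divide_distrib[symmetric])
    then have "a * ennreal (q / (q + l)) + a * ennreal (l / (q + l)) = a"
      using l \<open>0 < q\<close> by (simp add: distrib_left[symmetric] ennreal_plus[symmetric] del: ennreal_plus)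
    moreover have "a * ennreal (l / (q + l)) \<noteq> \<top>"
      using a by (simp add: ennreal_mult_eq_top_iff)
    ultimately have "a * ennreal (l / (q + l)) + (\<integral>\<^sup>+\<omega>. discount l (S \<omega>) \<partial>N)
        = a * ennreal (l / (q + l)) + a * ennreal (q / (q + l))" "a * ennreal (l / (q + l)) \<noteq> \<infinity>"
      using eq by (simp_all only: add.commute infinity_ennreal_def not_False_eq_True simp_thms)
    then show ?thesis by (simp only: ennreal_add_left_cancel simp_thms)
  qed
qed

section \<open>Expectations along the jump chain\<close>

lemma prod_lessThan_split:
  fixes F :: "nat \<Rightarrow> 'a :: comm_monoid_mult"
  assumes "m < n"
  shows "(\<Prod>k<n. F k) = F m * (\<Prod>k\<in>{..<n} - {m}. F k)"
  using assms by (subst prod.remove[of _ m]) auto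

locale regular_ctmc = ctmc M q Y S
  for M :: "'w measure" and q :: "'s::countable \<Rightarrow> 's \<Rightarrow> real"
    and Y :: "nat \<Rightarrow> 'w \<Rightarrow> 's" and S :: "nat \<Rightarrow> 'w \<Rightarrow> real" +
  assumes rate_nonneg: "\<And>x y. x \<noteq> y \<Longrightarrow> 0 \<le> q x y"
    and exit_rate_pos: "\<And>x. 0 < exit_rate q x"
begin

text \<open>A family of rates that is not summable would have exit rate \<open>0\<close>, the value that \<^const>\<open>infsum\<close> then takes.\<close>

lemma exit_rate_eq:
  "(\<integral>\<^sup>+y. ennreal (q x y) \<partial>count_space (- {x})) = ennreal (exit_rate q x)"
proof -
  have "q x summable_on - {x}"
    using exit_rate_pos[of x] infsum_not_exists[of "q x" "- {x}"] unfolding exit_rate_def by force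
  moreover have "(\<lambda>y. norm (q x y)) summable_on - {x} \<longleftrightarrow> q x summable_on - {x}"
    using rate_nonneg by (intro summable_on_cong) auto
  ultimately have "Infinite_Set_Sum.abs_summable_on (q x) (- {x})"
    by (simp add: abs_summable_equivalent[symmetric])
  then show ?thesis
    using rate_nonneg by (subst nn_integral_conv_infsetsum) (auto simp: infsetsum_infsum exit_rate_def)
qed

lemma measurable_chain [measurable]: "Y k \<in> measurable M (count_space UNIV)"
  by (rule measurable_jump_chain)

lemma measurable_holding [measurable]: "S k \<in> borel_measurable M"
  by (rule measurable_holding_time)

definition path_event :: "nat \<Rightarrow> (nat \<Rightarrow> 's) \<Rightarrow> 'w set" where
  "path_event n x = {\<omega> \<in> space M. \<forall>k\<le>n. Y k \<omega> = x k}"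

lemma path_event_sets [measurable]: "path_event n x \<in> sets M"
  unfolding path_event_def by measurable

lemma jump_prob_nonneg: "0 \<le> jump_prob q x y"
  using rate_nonneg exit_rate_pos[of x] by (auto simp: jump_prob_def)

text \<open>The transition probabilities weighted with the Laplace transform \<open>q / (q + l)\<close> of the holding
  time, \<open>q\<close> being the exit rate: the expectation of \<open>exp (- l S)\<close> over a jump to \<open>y\<close>. For \<open>l = 0\<close> these
  are the transition probabilities of the jump chain.\<close>

definition resolvent_kernel :: "real \<Rightarrow> 's \<Rightarrow> 's \<Rightarrow> real" where
  "resolvent_kernel l x y = (if y = x then 0 else q x y / (exit_rate q x + l))"

lemma resolvent_kernel_eq: "0 \<le> l \<Longrightarrow> resolvent_kernel l x y = exit_rate q x / (exit_rate q x + l) * jump_prob q x y"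
  using exit_rate_pos[of x] by (auto simp: resolvent_kernel_def jump_prob_def)

text \<open>The law of the chain prescribes the tails of the holding times along a path. Here they are turned
  into Laplace transforms one coordinate after the other, by induction on \<open>m\<close>: with the other factors
  collected in a density \<open>R\<close>, the tail of \<open>S m\<close> is exponential by the induction hypothesis for varying
  \<open>t m\<close>.\<close>

lemma joint_law:
  assumes t: "\<And>k. k < n \<Longrightarrow> 0 \<le> t k" and "0 \<le> l" and "m \<le> n"
  shows "(\<integral>\<^sup>+\<omega>. indicator (path_event n x) \<omega> *
      (\<Prod>k<n. if k < m then discount l (S k \<omega>) else indicator {t k<..} (S k \<omega>)) \<partial>M) =
    emeasure M {\<omega> \<in> space M. Y 0 \<omega> = x 0} *
      (\<Prod>k<n. if k < m then ennreal (resolvent_kernel l (x k) (x (Suc k)))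
        else ennreal (exp (- exit_rate q (x k) * t k) * jump_prob q (x k) (x (Suc k))))"
  using t \<open>m \<le> n\<close>
proof (induction m arbitrary: t)
  case 0
  have "indicator (path_event n x) \<omega> * (\<Prod>k<n. indicator {t k<..} (S k \<omega>)) =
      (indicator {\<omega> \<in> space M. (\<forall>k\<le>n. Y k \<omega> = x k) \<and> (\<forall>k<n. t k < S k \<omega>)} \<omega> :: ennreal)"
    if "\<omega> \<in> space M" for \<omega>
  proof (cases "\<forall>k<n. t k < S k \<omega>")
    case True
    then show ?thesis using that by (auto simp: indicator_def path_event_def)
  next
    case False
    then have "(\<Prod>k<n. indicator {t k<..} (S k \<omega>)) = (0::ennreal)"
      by (auto simp: indicator_def)
    then show ?thesis using False by (auto simp: indicator_def)
  qed
  then have "(\<integral>\<^sup>+\<omega>. indicator (path_event n x) \<omega> * (\<Prod>k<n. indicator {t k<..} (S k \<omega>)) \<partial>M)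
     = (\<integral>\<^sup>+\<omega>. indicator {\<omega> \<in> space M. (\<forall>k\<le>n. Y k \<omega> = x k) \<and> (\<forall>k<n. t k < S k \<omega>)} \<omega> \<partial>M)"
    by (intro nn_integral_cong) auto
  also have "\<dots> = emeasure M {\<omega> \<in> space M. (\<forall>k\<le>n. Y k \<omega> = x k) \<and> (\<forall>k<n. t k < S k \<omega>)}"
    by (subst nn_integral_indicator) auto
  also have "\<dots> = ennreal (prob {\<omega> \<in> space M. Y 0 \<omega> = x 0} *
        (\<Prod>k<n. exp (- exit_rate q (x k) * t k) * jump_prob q (x k) (x (Suc k))))"
    by (subst emeasure_eq_measure) (simp only: law[of n t x, OF 0(1)])
  also have "\<dots> = emeasure M {\<omega> \<in> space M. Y 0 \<omega> = x 0} *
        (\<Prod>k<n. ennreal (exp (- exit_rate q (x k) * t k) * jump_prob q (x k) (x (Suc k))))"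
    by (subst ennreal_mult) (auto simp: emeasure_eq_measure prod_ennreal jump_prob_nonneg intro!: prod_nonneg)
  finally show ?case by simp
next
  case (Suc m)
  then have m: "m < n" by simp
  let ?E = "exit_rate q (x m)"
  let ?J = "\<lambda>t k. ennreal (exp (- exit_rate q (x k) * t k) * jump_prob q (x k) (x (Suc k)))"
  let ?P0 = "emeasure M {\<omega> \<in> space M. Y 0 \<omega> = x 0}"
  define R where "R t \<omega> = indicator (path_event n x) \<omega> * (\<Prod>k\<in>{..<n} - {m}.
      if k < m then discount l (S k \<omega>) else indicator {t k<..} (S k \<omega>))" for t \<omega>
  define C where "C t = ?P0 * (\<Prod>k\<in>{..<n} - {m}.
      if k < m then ennreal (resolvent_kernel l (x k) (x (Suc k))) else ?J t k)" for t
  have meas: "(\<lambda>\<omega>. if k < m then discount l (S k \<omega>) else indicator {t k<..} (S k \<omega>)) \<in> borel_measurable M" for k and t :: "nat \<Rightarrow> real"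
    by (cases "k < m") auto
  have R [measurable]: "R t \<in> borel_measurable M" for t
    unfolding R_def by (intro borel_measurable_times_ennreal borel_measurable_prod meas) auto
  have R_le: "R t \<omega> \<le> 1" for \<omega>
    unfolding R_def using \<open>0 \<le> l\<close>
    by (intro mult_le_one prod_le_1) (auto simp: discount_le_1 indicator_def)
  have IH: "(\<integral>\<^sup>+\<omega>. indicator {s<..} (S m \<omega>) * R t \<omega> \<partial>M) = C t * jump_prob q (x m) (x (Suc m)) * exp (- ?E * s)"
    if "0 \<le> s" for s
  proof -
    let ?t = "t(m := s)"
    have R_upd: "R ?t = R t" and C_upd: "C ?t = C t"
      unfolding R_def C_def
      by (intro ext arg_cong2[where f = "(*)"] prod.cong refl; simp cong: if_cong)+
    have "(\<integral>\<^sup>+\<omega>. indicator {s<..} (S m \<omega>) * R ?t \<omega> \<partial>M) = (\<integral>\<^sup>+\<omega>. indicator (path_event n x) \<omega> *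
      (\<Prod>k<n. if k < m then discount l (S k \<omega>) else indicator {?t k<..} (S k \<omega>)) \<partial>M)"
      unfolding prod_lessThan_split[OF m] R_def
      by (intro nn_integral_cong) (simp add: mult_ac fun_upd_same del: fun_upd_apply)
    also have "\<dots> = ?P0 * (\<Prod>k<n. if k < m then ennreal (resolvent_kernel l (x k) (x (Suc k))) else ?J ?t k)"
      using Suc.prems that by (intro Suc.IH) auto
    also have "\<dots> = C ?t * ?J ?t m"
      unfolding prod_lessThan_split[OF m] C_def by (simp only: mult_ac less_irrefl if_False)
    also have "?J ?t m = jump_prob q (x m) (x (Suc m)) * ennreal (exp (- ?E * s))"
      by (simp add: ennreal_mult[symmetric] jump_prob_nonneg mult.commute)
    finally have "(\<integral>\<^sup>+\<omega>. indicator {s<..} (S m \<omega>) * R t \<omega> \<partial>M) =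
        C t * (jump_prob q (x m) (x (Suc m)) * ennreal (exp (- ?E * s)))"
      unfolding R_upd C_upd .
    then show ?thesis by (simp only: mult.assoc)
  qed
  let ?N = "density M (R t)"
  have tail: "emeasure ?N {\<omega> \<in> space ?N. s < S m \<omega>} = C t * jump_prob q (x m) (x (Suc m)) * exp (- ?E * s)"
    if "0 \<le> s" for s
    unfolding IH[OF that, symmetric]
    by (subst emeasure_density) (auto intro!: nn_integral_cong simp: indicator_def)
  have "finite_measure ?N"
  proof
    have "(\<integral>\<^sup>+\<omega>. R t \<omega> * indicator (space M) \<omega> \<partial>M) \<le> (\<integral>\<^sup>+\<omega>. 1 \<partial>M)"
      using R_le by (intro nn_integral_mono) (auto simp: indicator_def)
    then show "emeasure ?N (space ?N) \<noteq> \<infinity>"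
      by (auto simp: emeasure_density emeasure_space_1 top_unique)
  qed
  then have "(\<integral>\<^sup>+\<omega>. discount l (S m \<omega>) \<partial>?N) = C t * jump_prob q (x m) (x (Suc m)) * ennreal (?E / (?E + l))"
    using \<open>0 \<le> l\<close> exit_rate_pos tail by (intro nn_integral_discount_exponential) auto
  also have "\<dots> = C t * ennreal (resolvent_kernel l (x m) (x (Suc m)))"
  proof -
    have "ennreal (resolvent_kernel l (x m) (x (Suc m))) = jump_prob q (x m) (x (Suc m)) * ennreal (?E / (?E + l))"
      using \<open>0 \<le> l\<close> exit_rate_pos[of "x m"]
      by (simp add: resolvent_kernel_eq ennreal_mult[symmetric] jump_prob_nonneg mult.commute)
    then show ?thesis by (simp only: mult.assoc)
  qed
  also have "C t * ennreal (resolvent_kernel l (x m) (x (Suc m))) = ?P0 * (\<Prod>k<n. if k < Suc m then ennreal (resolvent_kernel l (x k) (x (Suc k))) else ?J t k)"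
  proof -
    have "(\<Prod>k\<in>{..<n} - {m}. if k < m then ennreal (resolvent_kernel l (x k) (x (Suc k))) else ?J t k) =
        (\<Prod>k\<in>{..<n} - {m}. if k < Suc m then ennreal (resolvent_kernel l (x k) (x (Suc k))) else ?J t k)"
      by (intro prod.cong) auto
    then show ?thesis unfolding prod_lessThan_split[OF m] C_def by (simp only: mult_ac lessI if_True)
  qed
  also have "(\<integral>\<^sup>+\<omega>. discount l (S m \<omega>) \<partial>?N) = (\<integral>\<^sup>+\<omega>. R t \<omega> * discount l (S m \<omega>) \<partial>M)"
    by (subst nn_integral_density) auto
  also have "\<dots> = (\<integral>\<^sup>+\<omega>. indicator (path_event n x) \<omega> *
      (\<Prod>k<n. if k < Suc m then discount l (S k \<omega>) else indicator {t k<..} (S k \<omega>)) \<partial>M)"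
  proof (intro nn_integral_cong)
    fix \<omega>
    have "(\<Prod>k\<in>{..<n} - {m}. if k < m then discount l (S k \<omega>) else indicator {t k<..} (S k \<omega>)) =
        (\<Prod>k\<in>{..<n} - {m}. if k < Suc m then discount l (S k \<omega>) else indicator {t k<..} (S k \<omega>))"
      by (intro prod.cong) auto
    then show "R t \<omega> * discount l (S m \<omega>) = indicator (path_event n x) \<omega> *
      (\<Prod>k<n. if k < Suc m then discount l (S k \<omega>) else indicator {t k<..} (S k \<omega>))"
      unfolding prod_lessThan_split[OF m] R_def by (simp only: mult_ac lessI if_True)
  qed
  finally show ?case .
qed

definition resolvent_step :: "real \<Rightarrow> ('s \<Rightarrow> ennreal) \<Rightarrow> 's \<Rightarrow> ennreal" where
  "resolvent_step l h x = (\<integral>\<^sup>+y. ennreal (resolvent_kernel l x y) * h y \<partial>count_space UNIV)"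

text \<open>Written with rates, a function \<open>f\<close> satisfies \<open>resolvent_step l f \<le> f\<close> iff its drift
  under the generator is at most \<open>l f\<close>. This is how the hypotheses of the two criteria below enter.\<close>

lemma resolvent_step_eq:
  assumes "0 \<le> l"
  shows "resolvent_step l h x =
    (\<integral>\<^sup>+y. ennreal (q x y) * h y \<partial>count_space (- {x})) / ennreal (exit_rate q x + l)"
proof -
  have "resolvent_step l h x = (\<integral>\<^sup>+y. ennreal (resolvent_kernel l x y) * h y * indicator (- {x}) y \<partial>count_space UNIV)"
    unfolding resolvent_step_def by (intro nn_integral_cong) (auto simp: resolvent_kernel_def indicator_def)
  also have "\<dots> = (\<integral>\<^sup>+y. ennreal (resolvent_kernel l x y) * h y \<partial>count_space (- {x}))"
    by (simp add: nn_integral_count_space_indicator)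
  also have "\<dots> = (\<integral>\<^sup>+y. ennreal (q x y) * h y / ennreal (exit_rate q x + l) \<partial>count_space (- {x}))"
  proof (intro nn_integral_cong)
    fix y assume "y \<in> space (count_space (- {x}))"
    then have "ennreal (resolvent_kernel l x y) = ennreal (q x y) / ennreal (exit_rate q x + l)"
      using \<open>0 \<le> l\<close> exit_rate_pos[of x] rate_nonneg[of x y]
      by (subst divide_ennreal) (auto simp: resolvent_kernel_def)
    then show "ennreal (resolvent_kernel l x y) * h y = ennreal (q x y) * h y / ennreal (exit_rate q x + l)"
      by (simp only: divide_ennreal_def mult_ac)
  qed
  also have "\<dots> = (\<integral>\<^sup>+y. ennreal (q x y) * h y \<partial>count_space (- {x})) / ennreal (exit_rate q x + l)"
    by (rule nn_integral_divide) auto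
  finally show ?thesis .
qed

lemma resolvent_step_mono: "(\<And>y. h y \<le> h' y) \<Longrightarrow> resolvent_step l h x \<le> resolvent_step l h' x"
  unfolding resolvent_step_def by (intro nn_integral_mono mult_left_mono) auto

lemma resolvent_step_add:
  "resolvent_step l (\<lambda>y. h y + h' y) x = resolvent_step l h x + resolvent_step l h' x"
  unfolding resolvent_step_def by (simp add: distrib_left nn_integral_add)

lemma resolvent_step_cmult:
  "resolvent_step l (\<lambda>y. c * h y) x = c * resolvent_step l h x"
  unfolding resolvent_step_def by (simp add: nn_integral_cmult[symmetric] mult_ac)

lemma resolvent_step_one: "0 \<le> l \<Longrightarrow> resolvent_step l (\<lambda>_. 1) x = ennreal (exit_rate q x / (exit_rate q x + l))"
  using exit_rate_pos[of x] by (simp add: resolvent_step_eq exit_rate_eq divide_ennreal del: ennreal_plus)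

lemma resolvent_step_zero_one: "resolvent_step 0 (\<lambda>_. 1) = (\<lambda>_. 1)"
  using exit_rate_pos 
  by (auto simp: resolvent_step_one intro!: ext) (metis divide_self ennreal_1 exit_rate_pos less_irrefl)

lemma resolvent_step_le_1: "0 \<le> l \<Longrightarrow> (\<And>y. h y \<le> 1) \<Longrightarrow> resolvent_step l h x \<le> 1"
  by (rule order_trans[OF resolvent_step_mono[of h "\<lambda>_. 1"]])
     (use exit_rate_pos[of x] in \<open>auto simp: resolvent_step_one ennreal_le_1\<close>)

text \<open>Summing over the next state extends a prescribed path by one step; the induction therefore runs
  over the number \<open>n\<close> of free steps after a prescribed path of any length \<open>m\<close>.\<close>

lemma path_event_expectation:
  assumes l: "0 \<le> l"
  shows "(\<integral>\<^sup>+\<omega>. indicator (path_event m x) \<omega> * (\<Prod>k<m + n. discount l (S k \<omega>)) * h (Y (m + n) \<omega>) \<partial>M) =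
    emeasure M {\<omega> \<in> space M. Y 0 \<omega> = x 0} * (\<Prod>k<m. ennreal (resolvent_kernel l (x k) (x (Suc k)))) *
    (resolvent_step l ^^ n) h (x m)"
proof (induction n arbitrary: m x)
  case 0
  have "(\<integral>\<^sup>+\<omega>. indicator (path_event m x) \<omega> * (\<Prod>k<m. discount l (S k \<omega>)) * h (Y m \<omega>) \<partial>M)
     = (\<integral>\<^sup>+\<omega>. indicator (path_event m x) \<omega> * (\<Prod>k<m. discount l (S k \<omega>)) * h (x m) \<partial>M)"
    by (intro nn_integral_cong) (auto simp: indicator_def path_event_def)
  also have "\<dots> = (\<integral>\<^sup>+\<omega>. indicator (path_event m x) \<omega> * (\<Prod>k<m. discount l (S k \<omega>)) \<partial>M) * h (x m)"
    by (intro nn_integral_multc) auto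
  also have "(\<integral>\<^sup>+\<omega>. indicator (path_event m x) \<omega> * (\<Prod>k<m. discount l (S k \<omega>)) \<partial>M) =
      emeasure M {\<omega> \<in> space M. Y 0 \<omega> = x 0} * (\<Prod>k<m. ennreal (resolvent_kernel l (x k) (x (Suc k))))"
    using joint_law[of m "\<lambda>_. 0" l m x] l by simp
  finally show ?case by simp
next
  case (Suc n)
  let ?x = "\<lambda>y. x(Suc m := y)"
  let ?P0 = "emeasure M {\<omega> \<in> space M. Y 0 \<omega> = x 0}"
  let ?F = "\<lambda>\<omega>. (\<Prod>k<Suc m + n. discount l (S k \<omega>)) * h (Y (Suc m + n) \<omega>)"
  have split: "indicator (path_event m x) \<omega> = (\<integral>\<^sup>+y. indicator (path_event (Suc m) (?x y)) \<omega> \<partial>count_space UNIV)" if "\<omega> \<in> space M" for \<omega>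
  proof -
    have "(\<integral>\<^sup>+y. indicator (path_event (Suc m) (?x y)) \<omega> \<partial>count_space UNIV)
       = (\<integral>\<^sup>+y. indicator (path_event m x) \<omega> * indicator {Y (Suc m) \<omega>} y \<partial>count_space UNIV)"
      using that by (intro nn_integral_cong) (auto simp: indicator_def path_event_def le_Suc_eq)
    then show ?thesis by (simp add: nn_integral_cmult)
  qed
  have "(\<integral>\<^sup>+\<omega>. indicator (path_event m x) \<omega> * (\<Prod>k<m + Suc n. discount l (S k \<omega>)) * h (Y (m + Suc n) \<omega>) \<partial>M)
     = (\<integral>\<^sup>+\<omega>. (\<integral>\<^sup>+y. indicator (path_event (Suc m) (?x y)) \<omega> * ?F \<omega> \<partial>count_space UNIV) \<partial>M)"
  proof (intro nn_integral_cong)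
    fix \<omega> assume "\<omega> \<in> space M"
    have "indicator (path_event m x) \<omega> * ?F \<omega>
        = (\<integral>\<^sup>+y. indicator (path_event (Suc m) (?x y)) \<omega> * ?F \<omega> \<partial>count_space UNIV)"
      unfolding split[OF \<open>\<omega> \<in> space M\<close>] by (rule nn_integral_multc[symmetric]) auto
    then show "indicator (path_event m x) \<omega> * (\<Prod>k<m + Suc n. discount l (S k \<omega>)) * h (Y (m + Suc n) \<omega>)
        = (\<integral>\<^sup>+y. indicator (path_event (Suc m) (?x y)) \<omega> * ?F \<omega> \<partial>count_space UNIV)"
      by (simp only: add_Suc_right add_Suc mult.assoc)
  qed
  also have "\<dots> = (\<integral>\<^sup>+y. (\<integral>\<^sup>+\<omega>. indicator (path_event (Suc m) (?x y)) \<omega> * ?F \<omega> \<partial>M) \<partial>count_space UNIV)"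
    by (intro nn_integral_count_space_nn_integral) auto
  also have "\<dots> = (\<integral>\<^sup>+y. (?P0 * (\<Prod>k<m. ennreal (resolvent_kernel l (x k) (x (Suc k))))) *
      (ennreal (resolvent_kernel l (x m) y) * (resolvent_step l ^^ n) h y) \<partial>count_space UNIV)"
  proof (intro nn_integral_cong)
    fix y
    have "(\<Prod>k<m. ennreal (resolvent_kernel l (?x y k) (?x y (Suc k)))) = (\<Prod>k<m. ennreal (resolvent_kernel l (x k) (x (Suc k))))"
      by (intro prod.cong) auto
    then show "(\<integral>\<^sup>+\<omega>. indicator (path_event (Suc m) (?x y)) \<omega> * ?F \<omega> \<partial>M) =
      (?P0 * (\<Prod>k<m. ennreal (resolvent_kernel l (x k) (x (Suc k))))) *
      (ennreal (resolvent_kernel l (x m) y) * (resolvent_step l ^^ n) h y)"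
      using Suc.IH[of "Suc m" "?x y"] by (simp add: mult_ac fun_upd_def)
  qed
  also have "\<dots> = ?P0 * (\<Prod>k<m. ennreal (resolvent_kernel l (x k) (x (Suc k)))) *
      resolvent_step l ((resolvent_step l ^^ n) h) (x m)"
    unfolding resolvent_step_def[of l "(resolvent_step l ^^ n) h"] by (rule nn_integral_cmult) auto
  finally show ?case by simp
qed

text \<open>All that is needed about the law of the chain. With \<open>l = 0\<close> and an indicator for \<open>h\<close> the right hand
  side is an \<open>n\<close>-step transition probability, with \<open>h = 1\<close> it is the Laplace transform of the time of the
  \<open>n\<close>-th jump.\<close>

lemma start_expectation:
  assumes "0 \<le> l"
  shows "(\<integral>\<^sup>+\<omega>. indicator {\<omega> \<in> space M. Y 0 \<omega> = x} \<omega> * (\<Prod>k<n. discount l (S k \<omega>)) * h (Y n \<omega>) \<partial>M) =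
    emeasure M {\<omega> \<in> space M. Y 0 \<omega> = x} * (resolvent_step l ^^ n) h x"
  using path_event_expectation[OF assms, of 0 "\<lambda>_. x" n h] by (simp add: path_event_def)

lemma AE_startI:
  assumes "\<And>x. AE \<omega> in M. Y 0 \<omega> = x \<longrightarrow> P \<omega>"
  shows "AE \<omega> in M. P \<omega>"
proof -
  have "AE \<omega> in M. \<forall>x. Y 0 \<omega> = x \<longrightarrow> P \<omega>"
    using assms by (subst AE_all_countable) auto
  then show ?thesis by eventually_elim auto
qed

text \<open>The discount with \<open>l = 0\<close> is the indicator of a positive holding time, and it loses no mass because
  the transition probabilities add up to \<open>1\<close>.\<close>

lemma AE_holding_time_pos: "AE \<omega> in M. \<forall>k. 0 < S k \<omega>"
proof -
  have "AE \<omega> in M. 0 < S k \<omega>" for k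
  proof (rule AE_startI)
    fix x
    let ?A = "{\<omega> \<in> space M. Y 0 \<omega> = x}" and ?B = "{\<omega> \<in> space M. \<forall>i<Suc k. 0 < S i \<omega>}"
    have iter: "(resolvent_step 0 ^^ n) (\<lambda>_. 1) = (\<lambda>_. 1)" for n
      by (induction n) (auto simp: resolvent_step_zero_one)
    have "emeasure M (?A \<inter> ?B) = (\<integral>\<^sup>+\<omega>. indicator ?A \<omega> * (\<Prod>i<Suc k. discount 0 (S i \<omega>)) * 1 \<partial>M)"
    proof (subst nn_integral_indicator[symmetric], simp, intro nn_integral_cong)
      fix \<omega> assume "\<omega> \<in> space M"
      show "indicator (?A \<inter> ?B) \<omega> = indicator ?A \<omega> * (\<Prod>i<Suc k. discount 0 (S i \<omega>)) * 1"
      proof (cases "\<omega> \<in> ?B")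
        case True
        then show ?thesis by (auto simp: indicator_def discount_def)
      next
        case False
        then have "(\<Prod>i<Suc k. discount 0 (S i \<omega>)) = 0"
          using \<open>\<omega> \<in> space M\<close> by (intro prod_zero) (auto simp: discount_def)
        then show ?thesis using False by (auto simp: indicator_def)
      qed
    qed
    also have "\<dots> = emeasure M ?A"
      using start_expectation[of 0 x "Suc k" "\<lambda>_. 1"] by (simp only: iter) simp
    finally have "emeasure M (?A - ?A \<inter> ?B) = 0"
      by (subst emeasure_Diff) auto
    moreover have "?A - ?A \<inter> ?B = ?A - ?B" by auto
    ultimately have "emeasure M (?A - ?B) = 0" by simp
    then have "AE \<omega> in M. \<omega> \<notin> ?A - ?B"
      by (intro AE_not_in) (auto simp: null_sets_def)
    then show "AE \<omega> in M. Y 0 \<omega> = x \<longrightarrow> 0 < S k \<omega>"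
      using AE_space by eventually_elim auto
  qed
  then show ?thesis by (simp add: AE_all_countable)
qed

section \<open>Drift criteria for non-explosion and transience\<close>

lemma resolvent_iter_le_1:
  assumes "0 \<le> l"
  shows "(resolvent_step l ^^ n) (\<lambda>_. 1) x \<le> 1"
  using assms by (induction n arbitrary: x) (auto intro: resolvent_step_le_1)

lemma resolvent_iter_add:
  "(resolvent_step l ^^ n) (\<lambda>y. h y + h' y) = (\<lambda>x. (resolvent_step l ^^ n) h x + (resolvent_step l ^^ n) h' x)"
  by (induction n) (auto simp: resolvent_step_add)

text \<open>A discrete maximum principle. Where \<open>e f \<ge> 1\<close>, the trivial bound \<open>1\<close> suffices. Where \<open>e f < 1\<close>, the exit
  rate is at most \<open>R\<close>, so a jump costs a factor \<open>R / (R + K)\<close>, while the drift condition keeps \<open>e f\<close> from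
  growing.\<close>

lemma resolvent_iter_bound:
  fixes f :: "'s \<Rightarrow> real"
  assumes "0 < K" and f: "\<And>x. 0 \<le> f x"
    and drift: "\<And>x. (\<integral>\<^sup>+y. ennreal (q x y) * ennreal (f y) \<partial>count_space (- {x}))
      \<le> ennreal ((exit_rate q x + K) * f x)"
    and "0 < e" and R: "\<And>x. f x < 1 / e \<Longrightarrow> exit_rate q x \<le> R" and "0 \<le> R"
  shows "(resolvent_step K ^^ n) (\<lambda>_. 1) x \<le> ennreal (e * f x + (R / (R + K)) ^ n)"
proof (induction n arbitrary: x)
  case 0
  then show ?case using f \<open>0 < e\<close> by (simp add: ennreal_1[symmetric] del: ennreal_1)
next
  case (Suc n)
  define r where "r = R / (R + K)"
  let ?E = "exit_rate q x"
  have r: "0 \<le> r" using \<open>0 < K\<close> \<open>0 \<le> R\<close> by (simp add: r_def)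
  have E: "0 < ?E + K" using exit_rate_pos[of x] \<open>0 < K\<close> by simp
  show ?case
  proof (cases "f x < 1 / e")
    case False
    then have "1 \<le> e * f x + r ^ Suc n"
      using \<open>0 < e\<close> zero_le_power[OF r, of "Suc n"] by (simp add: field_simps)
    then have "1 \<le> ennreal (e * f x + r ^ Suc n)"
      by (simp add: ennreal_1[symmetric] del: ennreal_1)
    then show ?thesis using resolvent_iter_le_1[of K "Suc n" x] \<open>0 < K\<close> unfolding r_def by (meson less_imp_le order_trans)
  next
    case True
    have "resolvent_step K (\<lambda>y. ennreal (f y)) x \<le> ennreal ((?E + K) * f x) / ennreal (?E + K)"
      using \<open>0 < K\<close> by (subst resolvent_step_eq) (auto intro!: divide_right_mono_ennreal drift simp del: ennreal_plus)
    also have "\<dots> = ennreal (f x)"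
      using E f[of x] by (subst divide_ennreal) auto
    finally have step_f: "resolvent_step K (\<lambda>y. ennreal (f y)) x \<le> ennreal (f x)" .
    have "?E / (?E + K) \<le> r"
      using R[OF True] E \<open>0 < K\<close> \<open>0 \<le> R\<close> by (simp add: r_def field_simps)
    then have step_1: "resolvent_step K (\<lambda>_. 1) x \<le> ennreal r"
      using \<open>0 < K\<close> by (subst resolvent_step_one) (auto intro: ennreal_leI)
    have "resolvent_step K ((resolvent_step K ^^ n) (\<lambda>_. 1)) x
        \<le> resolvent_step K (\<lambda>y. ennreal e * ennreal (f y) + ennreal (r ^ n) * 1) x"
      using Suc[folded r_def] \<open>0 < e\<close> f r
      by (intro resolvent_step_mono) (simp add: ennreal_mult[symmetric] ennreal_plus[symmetric] del: ennreal_plus)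
    also have "\<dots> = ennreal e * resolvent_step K (\<lambda>y. ennreal (f y)) x + ennreal (r ^ n) * resolvent_step K (\<lambda>_. 1) x"
      by (simp only: resolvent_step_add resolvent_step_cmult)
    also have "\<dots> \<le> ennreal e * ennreal (f x) + ennreal (r ^ n) * ennreal r"
      by (intro add_mono mult_left_mono step_f step_1) auto
    also have "\<dots> = ennreal (e * f x + r ^ Suc n)"
      using r f[of x] \<open>0 < e\<close>
      by (simp add: ennreal_mult[symmetric] ennreal_plus[symmetric] mult.commute del: ennreal_plus)
    finally show ?thesis unfolding r_def by simp
  qed
qed

lemma prod_discount_eq:
  assumes "\<And>k. 0 < S k \<omega>"
  shows "(\<Prod>k<n. discount l (S k \<omega>)) = ennreal (exp (- l * jump_time S n \<omega>))"
proof -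
  have "(\<Prod>k<n. discount l (S k \<omega>)) = (\<Prod>k<n. ennreal (exp (- l * S k \<omega>)))"
    using assms by (simp add: discount_def)
  also have "\<dots> = ennreal (\<Prod>k<n. exp (- l * S k \<omega>))" by (simp add: prod_ennreal)
  also have "(\<Prod>k<n. exp (- l * S k \<omega>)) = exp (- l * jump_time S n \<omega>)"
    by (simp add: exp_sum[symmetric] jump_time_def sum_distrib_left sum_negf)
  finally show ?thesis .
qed

text \<open>If \<open>f\<close> grows at most exponentially in mean, it stays finite up to an explosion, and then so do the rates
  met on the way, which rules the explosion out. In terms of expectations: the Laplace transform of the
  \<open>n\<close>-th jump time is at most \<open>e f + r ^ n\<close> with \<open>r < 1\<close>, for every \<open>e > 0\<close>, hence tends to \<open>0\<close>.\<close>

lemma non_explosive_if_drift_le: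
  fixes f :: "'s \<Rightarrow> real"
  assumes K: "0 < K" and f: "\<And>x. 0 \<le> f x"
    and drift: "\<And>x. (\<integral>\<^sup>+y. ennreal (q x y) * ennreal (f y) \<partial>count_space (- {x}))
      \<le> ennreal ((exit_rate q x + K) * f x)"
    and bdd: "\<And>b. \<exists>R. \<forall>x. f x < b \<longrightarrow> exit_rate q x \<le> R"
  shows "non_explosive M S"
  unfolding non_explosive_def
proof (rule AE_startI)
  fix x
  let ?A = "{\<omega> \<in> space M. Y 0 \<omega> = x}"
  define D where "D n \<omega> = indicator ?A \<omega> * (\<Prod>k<n. discount K (S k \<omega>))" for n \<omega>
  have [measurable]: "D n \<in> borel_measurable M" for n unfolding D_def by measurable
  have "(\<integral>\<^sup>+\<omega>. (INF n. D n \<omega>) \<partial>M) \<le> 0 + ennreal e" if "0 < e" for e :: real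
  proof -
    have e2: "0 < e / 2" using that by simp
    define d where "d = e / (2 * (f x + 1))"
    have fx: "0 < f x + 1" using f[of x] by simp
    have d: "0 < d" "d * f x \<le> e / 2" using fx that by (auto simp: d_def field_simps)
    obtain R where R: "\<And>y. f y < 1 / d \<Longrightarrow> exit_rate q y \<le> R" using bdd by metis
    have R': "exit_rate q y \<le> max R 0" if "f y < 1 / d" for y using R[OF that] by simp
    let ?r = "max R 0 / (max R 0 + K)"
    have "0 \<le> ?r" "?r < 1" using K by auto
    then obtain n where n: "?r ^ n < e / 2"
      using real_arch_pow_inv[OF e2] by blast
    have "(\<integral>\<^sup>+\<omega>. (INF n. D n \<omega>) \<partial>M) \<le> (\<integral>\<^sup>+\<omega>. D n \<omega> \<partial>M)"
      by (intro nn_integral_mono INF_lower) auto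
    also have "\<dots> = emeasure M ?A * (resolvent_step K ^^ n) (\<lambda>_. 1) x"
      using start_expectation[of K x n "\<lambda>_. 1"] K by (simp add: D_def)
    also have "\<dots> \<le> 1 * (resolvent_step K ^^ n) (\<lambda>_. 1) x"
      by (intro mult_right_mono) (auto simp: emeasure_le_1)
    also have "\<dots> \<le> ennreal (d * f x + ?r ^ n)"
      using resolvent_iter_bound[OF K f drift d(1) R', of n x] by simp
    also have "\<dots> \<le> ennreal e" using d n by (intro ennreal_leI) auto
    finally show ?thesis by simp
  qed
  then have "(\<integral>\<^sup>+\<omega>. (INF n. D n \<omega>) \<partial>M) \<le> 0" by (rule ennreal_le_epsilon)
  then have "(\<integral>\<^sup>+\<omega>. (INF n. D n \<omega>) \<partial>M) = 0" by (simp only: le_zero_eq)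
  then have "AE \<omega> in M. (INF n. D n \<omega>) = 0"
    by (rule nn_integral_0_iff_AE[THEN iffD1, rotated]) measurable
  then show "AE \<omega> in M. Y 0 \<omega> = x \<longrightarrow> (\<forall>t. finite {k. jump_time S k \<omega> \<le> t})"
    using AE_holding_time_pos AE_space
  proof eventually_elim
    case (elim \<omega>)
    show ?case
    proof (intro impI allI)
      fix t assume "Y 0 \<omega> = x"
      then have D: "D n \<omega> = ennreal (exp (- K * jump_time S n \<omega>))" for n
        using elim prod_discount_eq[of \<omega> K n] by (simp add: D_def)
      show "finite {k. jump_time S k \<omega> \<le> t}"
      proof (rule ccontr)
        assume inf: "infinite {k. jump_time S k \<omega> \<le> t}"
        have "ennreal (exp (- K * t)) \<le> D n \<omega>" for n
        proof -
          obtain k where "n \<le> k" "jump_time S k \<omega> \<le> t"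
            using inf unfolding infinite_nat_iff_unbounded_le by auto
          moreover have "jump_time S n \<omega> \<le> jump_time S k \<omega>"
            unfolding jump_time_def using elim \<open>n \<le> k\<close>
            by (intro sum_mono2) (auto simp: less_imp_le)
          ultimately show ?thesis unfolding D using K by (intro ennreal_leI) auto
        qed
        then have "ennreal (exp (- K * t)) \<le> (INF n. D n \<omega>)" by (rule INF_greatest)
        then show False using elim(1) by simp
      qed
    qed
  qed
qed

text \<open>Let \<open>P\<close> be the transition operator of the jump chain and \<open>d = f - P f > 0\<close>. Telescoping bounds
  \<open>\<Sum>k. P ^^ k d\<close> by \<open>f\<close>, so the expected number of visits to \<open>z\<close> is at most \<open>f / d z\<close>, and
  Borel-Cantelli applies.\<close>

lemma AE_finite_visits_if_drift_neg:
  fixes f :: "'s \<Rightarrow> real"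
  assumes f: "\<And>x. 0 \<le> f x"
    and drift: "\<And>x. (\<integral>\<^sup>+y. ennreal (q x y) * ennreal (f y) \<partial>count_space (- {x}))
      < ennreal (exit_rate q x * f x)"
  shows "AE \<omega> in M. finite {k. Y k \<omega> = z}"
proof (rule AE_startI)
  fix x
  let ?P = "resolvent_step 0" and ?f = "\<lambda>y. ennreal (f y)"
  have less: "?P ?f y < ?f y" for y
  proof -
    let ?I = "\<integral>\<^sup>+y'. ennreal (q y y') * ?f y' \<partial>count_space (- {y})"
    obtain r where r: "?I = ennreal r" "0 \<le> r"
      using drift[of y] by (cases ?I) auto
    then have "r < exit_rate q y * f y"
      using drift[of y] by (simp add: ennreal_less_iff)
    then have "r / exit_rate q y < f y"
      using exit_rate_pos[of y] by (simp add: field_simps)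
    then show ?thesis
      using exit_rate_pos[of y] r by (simp add: resolvent_step_eq divide_ennreal ennreal_less_iff)
  qed
  define d where "d y = ?f y - ?P ?f y" for y
  have d_add: "?f = (\<lambda>y. ?P ?f y + d y)"
    using less by (auto simp: d_def fun_eq_iff add_diff_inverse_ennreal less_imp_le)
  have d_pos: "0 < d y" for y using less[of y] by (simp add: d_def diff_gr0_ennreal)
  have d_le: "d y \<le> ?f y" for y by (simp add: d_def diff_le_self_ennreal)
  have "(\<Sum>k<n. (?P ^^ k) d x) + (?P ^^ n) ?f x = ?f x" for n
  proof (induction n)
    case (Suc n)
    have "(?P ^^ n) ?f x = (?P ^^ Suc n) ?f x + (?P ^^ n) d x"
      by (subst (1) d_add) (simp add: resolvent_iter_add funpow_swap1)
    then show ?case using Suc by (simp add: add_ac)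
  qed simp
  then have sum_le: "(\<Sum>k<n. (?P ^^ k) d x) \<le> ?f x" for n
    by (metis le_iff_add)
  define A where "A k = {\<omega> \<in> space M. Y 0 \<omega> = x \<and> Y k \<omega> = z}" for k
  have [measurable]: "A k \<in> sets M" for k unfolding A_def by measurable
  obtain c where c: "d z = ennreal c" "0 < c"
    using d_pos[of z] d_le[of z] by (cases "d z") (auto simp: top_unique)
  \<comment> \<open>almost surely the discounts with parameter \<open>0\<close> are all equal to \<open>1\<close>\<close>
  have visit: "ennreal (prob (A k) * c) \<le> (?P ^^ k) d x" for k
  proof -
    have "ennreal (prob (A k) * c) = (\<integral>\<^sup>+\<omega>. d z * indicator (A k) \<omega> \<partial>M)"
      using c by (simp add: nn_integral_cmult_indicator emeasure_eq_measure ennreal_mult mult.commute)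
    also have "\<dots> \<le> (\<integral>\<^sup>+\<omega>. indicator {\<omega> \<in> space M. Y 0 \<omega> = x} \<omega> * (\<Prod>i<k. discount 0 (S i \<omega>)) * d (Y k \<omega>) \<partial>M)"
      using AE_holding_time_pos
      by (intro nn_integral_mono_AE) (auto elim!: eventually_mono simp: discount_def A_def indicator_def)
    also have "\<dots> = emeasure M {\<omega> \<in> space M. Y 0 \<omega> = x} * (?P ^^ k) d x"
      by (simp add: start_expectation)
    also have "\<dots> \<le> 1 * (?P ^^ k) d x"
      by (intro mult_right_mono) (auto simp: emeasure_le_1)
    finally show ?thesis by simp
  qed
  have "summable (\<lambda>k. prob (A k))"
  proof (rule summableI_nonneg_bounded)
    fix n
    have "ennreal (\<Sum>k<n. prob (A k) * c) = (\<Sum>k<n. ennreal (prob (A k) * c))"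
      using c by (simp add: sum_ennreal)
    also have "\<dots> \<le> ?f x" using visit by (intro order_trans[OF sum_mono sum_le]) auto
    finally have "(\<Sum>k<n. prob (A k)) * c \<le> f x"
      using f[of x] by (simp add: sum_distrib_right)
    then show "(\<Sum>k<n. prob (A k)) \<le> f x / c" using c by (simp add: field_simps)
  qed simp
  then have "AE \<omega> in M. eventually (\<lambda>k. \<omega> \<in> space M - A k) sequentially"
    by (intro borel_cantelli_AE1) (auto simp: emeasure_eq_measure)
  then show "AE \<omega> in M. Y 0 \<omega> = x \<longrightarrow> finite {k. Y k \<omega> = z}"
    using AE_space
  proof eventually_elim
    case (elim \<omega>)
    then obtain n where "\<And>k. n \<le> k \<Longrightarrow> \<omega> \<notin> A k" unfolding eventually_sequentially by auto
    then have "{k. Y k \<omega> = z} \<subseteq> {..<n}" if "Y 0 \<omega> = x"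
      using that elim(2) by (auto simp: A_def not_less[symmetric])
    then show ?case by (auto intro: finite_subset)
  qed
qed

lemma transient_if_drift_neg:
  fixes f :: "'s \<Rightarrow> real"
  assumes f: "\<And>x. 0 \<le> f x"
    and drift: "\<And>x. (\<integral>\<^sup>+y. ennreal (q x y) * ennreal (f y) \<partial>count_space (- {x}))
      < ennreal (exit_rate q x * f x)"
  shows "transient M (chain_at Y S)"
  unfolding transient_def
proof
  fix z
  from AE_finite_visits_if_drift_neg[OF assms, of z]
  show "AE \<omega> in M. bdd_above {t. 0 \<le> t \<and> chain_at Y S t \<omega> = Some z}"
  proof eventually_elim
    case (elim \<omega>)
    let ?V = "{k. Y k \<omega> = z}" and ?T = "\<lambda>k. jump_time S (Suc k) \<omega>"
    show ?case
    proof (rule bdd_aboveI)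
      fix t assume "t \<in> {t. 0 \<le> t \<and> chain_at Y S t \<omega> = Some z}"
      then have ex: "\<exists>k. t < ?T k" and Y: "Y (LEAST k. t < ?T k) \<omega> = z"
        by (auto simp: chain_at_def split: if_splits)
      let ?k = "LEAST k. t < ?T k"
      have "t < ?T ?k" using ex by (rule LeastI_ex)
      also have "\<dots> \<le> \<bar>?T ?k\<bar>" by simp
      also have "\<dots> \<le> (\<Sum>k\<in>?V. \<bar>?T k\<bar>)"
        using elim Y by (intro member_le_sum) auto
      finally show "t \<le> (\<Sum>k\<in>?V. \<bar>?T k\<bar>)" by simp
    qed
  qed
qed

end

section \<open>A nonnegative top eigenvector of a symmetric matrix\<close>

text \<open>Cauchy-Schwarz for a semidefinite form is this inequality for its restriction to a line.\<close>

lemma discriminant_le_if_quadratic_nonneg: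
  fixes a b c :: real
  assumes nonneg: "\<And>t. 0 \<le> a + 2 * t * b + t\<^sup>2 * c" and "0 \<le> c"
  shows "b\<^sup>2 \<le> a * c"
proof (cases "c = 0")
  case True
  have "b = 0"
  proof (rule ccontr)
    assume "b \<noteq> 0"
    then show False using nonneg[of "- (a + 1) / (2 * b)"] True by (simp add: field_simps)
  qed
  then show ?thesis using True by simp
next
  case False
  then have "0 < c" using \<open>0 \<le> c\<close> by simp
  then show ?thesis using nonneg[of "- b / c"] by (simp add: field_simps power2_eq_square)
qed

lemma inner_symmetric_matrix:
  fixes A :: "real^'n^'n"
  assumes "transpose A = A"
  shows "x \<bullet> (A *v y) = (A *v x) \<bullet> y"
  by (metis assms dot_lmul_matrix transpose_matrix_vector)

lemma quadratic_form_add: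
  fixes A :: "real^'n^'n"
  assumes "transpose A = A"
  shows "(x + t *\<^sub>R y) \<bullet> (A *v (x + t *\<^sub>R y)) = x \<bullet> (A *v x) + 2 * t * (y \<bullet> (A *v x)) + t\<^sup>2 * (y \<bullet> (A *v y))"
  by (simp add: matrix_vector_right_distrib matrix_vector_mult_scaleR inner_add_left inner_add_right
      inner_symmetric_matrix[OF assms, of x y] inner_commute power2_eq_square algebra_simps)

text \<open>Eigenvectors for distinct eigenvalues are orthogonal. Finiteness is what gives the \<^const>\<open>Max\<close> in
  \<^const>\<open>largest_eigenvalue\<close> its meaning.\<close>

lemma finite_eigenvalues_symmetric:
  fixes A :: "real^'n^'n"
  assumes sym: "transpose A = A"
  shows "finite {l. eigenvalue A l}"
proof -
  let ?L = "{l. eigenvalue A l}"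
  obtain e where e: "\<And>l. l \<in> ?L \<Longrightarrow> e l \<noteq> 0 \<and> A *v e l = l *s e l"
    using bchoice[of ?L "\<lambda>l v. v \<noteq> 0 \<and> A *v v = l *s v"] by (auto simp: eigenvalue_def)
  have "orthogonal (e l) (e m)" if "l \<in> ?L" "m \<in> ?L" "l \<noteq> m" for l m
  proof -
    have "l * (e l \<bullet> e m) = m * (e l \<bullet> e m)"
      using inner_symmetric_matrix[OF sym, of "e l" "e m"] e[OF that(1)] e[OF that(2)]
      by (auto simp: scalar_mult_eq_scaleR)
    then show ?thesis using \<open>l \<noteq> m\<close> by (auto simp: orthogonal_def)
  qed
  then have orth: "orthogonal (e l) (e m) \<or> l = m" if "l \<in> ?L" "m \<in> ?L" for l m
    using that by blast
  have "inj_on e ?L"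
  proof (rule inj_onI)
    fix l m assume "l \<in> ?L" "m \<in> ?L" "e l = e m"
    then show "l = m" using orth[of l m] e[of m] by (auto simp: orthogonal_def)
  qed
  moreover have "finite (e ` ?L)"
    using orth by (intro pairwise_orthogonal_imp_finite) (auto simp: pairwise_def)
  ultimately show ?thesis by (rule finite_imageD[rotated])
qed

text \<open>A maximiser \<open>w\<close> of the quadratic form on the unit sphere is a top eigenvector. As the entries of \<open>A\<close> are
  nonnegative, replacing the coordinates of \<open>w\<close> by their absolute values can only increase the form, so
  the resulting vector \<open>v\<close> is a maximiser as well.\<close>

lemma nonneg_top_eigenvector:
  fixes A :: "real^'n^'n"
  assumes sym: "transpose A = A" and nonneg: "\<And>i j. 0 \<le> A $ i $ j"
  obtains v where "norm v = 1" "\<And>i. 0 \<le> v $ i" "A *v v = largest_eigenvalue A *\<^sub>R v"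
    "\<And>x. x \<bullet> (A *v x) \<le> largest_eigenvalue A * (x \<bullet> x)"
proof -
  let ?q = "\<lambda>x. x \<bullet> (A *v x)"
  have "axis undefined 1 \<in> sphere (0 :: real^'n) 1" by simp
  then have "sphere (0 :: real^'n) 1 \<noteq> {}" by blast
  moreover have "continuous_on (sphere 0 1) ?q"
    by (intro continuous_intros linear_continuous_on matrix_vector_mul_bounded_linear)
  ultimately obtain w where w: "norm w = 1" and max: "\<And>x. norm x = 1 \<Longrightarrow> ?q x \<le> ?q w"
    using continuous_attains_sup[OF compact_sphere, of "0 :: real^'n" 1 ?q] by auto
  define m where "m = ?q w"
  have le: "?q x \<le> m * (x \<bullet> x)" for x
  proof (cases "x = 0")
    case False
    have "?q ((1 / norm x) *\<^sub>R x) \<le> m" unfolding m_def using False by (intro max) simp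
    then show ?thesis
      using False by (simp add: matrix_vector_mult_scaleR dot_square_norm field_simps power2_eq_square)
  qed simp
  define v where "v = (\<chi> i. \<bar>w $ i\<bar>)"
  have "v \<bullet> v = w \<bullet> w" by (simp add: v_def inner_vec_def)
  then have vv: "v \<bullet> v = 1" and v1: "norm v = 1" using w by (simp_all add: norm_eq_1)
  have q_sum: "?q x = (\<Sum>i\<in>UNIV. \<Sum>j\<in>UNIV. A $ i $ j * (x $ i * x $ j))" for x
    by (simp add: inner_vec_def matrix_vector_mult_def sum_distrib_left mult_ac)
  have "w $ i * w $ j \<le> v $ i * v $ j" for i j
    using abs_ge_self[of "w $ i * w $ j"] by (simp add: v_def abs_mult)
  then have "m \<le> ?q v"
    unfolding m_def q_sum by (intro sum_mono mult_left_mono nonneg)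
  \<comment> \<open>the form \<open>m (x \<bullet> x) - x \<bullet> A x\<close> is nonnegative and vanishes at \<open>v\<close>, so by Cauchy-Schwarz \<open>v\<close> is in its radical\<close>
  have orth: "y \<bullet> (m *\<^sub>R v - A *v v) = 0" for y
  proof -
    have "(y \<bullet> (m *\<^sub>R v - A *v v))\<^sup>2 \<le> 0 * (m * (y \<bullet> y) - ?q y)"
    proof (rule discriminant_le_if_quadratic_nonneg)
      fix t
      have "0 \<le> m * ((v + t *\<^sub>R y) \<bullet> (v + t *\<^sub>R y)) - ?q (v + t *\<^sub>R y)" using le by simp
      also have "\<dots> = (m * (v \<bullet> v) - ?q v) + 2 * t * (y \<bullet> (m *\<^sub>R v - A *v v)) + t\<^sup>2 * (m * (y \<bullet> y) - ?q y)"
        unfolding quadratic_form_add[OF sym]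
        by (simp add: inner_add_left inner_add_right inner_diff_right inner_commute power2_eq_square algebra_simps)
      also have "\<dots> \<le> 0 + 2 * t * (y \<bullet> (m *\<^sub>R v - A *v v)) + t\<^sup>2 * (m * (y \<bullet> y) - ?q y)"
        using \<open>m \<le> ?q v\<close> vv by simp
      finally show "0 \<le> \<dots>" .
    qed (use le in simp)
    then show ?thesis by simp
  qed
  have Av: "A *v v = m *\<^sub>R v"
    using orth[of "m *\<^sub>R v - A *v v"] by simp
  have "largest_eigenvalue A = m"
    unfolding largest_eigenvalue_def
  proof (rule Max_eqI[OF finite_eigenvalues_symmetric[OF sym]])
    fix l assume "l \<in> {l. eigenvalue A l}"
    then obtain x where x: "x \<noteq> 0" "A *v x = l *\<^sub>R x"
      by (auto simp: eigenvalue_def scalar_mult_eq_scaleR)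
    then show "l \<le> m" using le[of x] by simp
  next
    show "m \<in> {l. eigenvalue A l}"
      using v1 Av by (auto simp: eigenvalue_def scalar_mult_eq_scaleR intro!: exI[of _ v])
  qed
  then show ?thesis using that[of v] v1 Av le by (simp add: v_def)
qed

section \<open>The generator of the birth-and-death chain\<close>

definition interaction_matrix :: "real \<Rightarrow> real \<Rightarrow> ('n::finite \<Rightarrow> 'n \<Rightarrow> bool) \<Rightarrow> real^'n^'n" where
  "interaction_matrix \<alpha> \<beta> E = mat \<alpha> + \<beta> *\<^sub>R adjacency_matrix E"

definition real_vec :: "nat^'n \<Rightarrow> real^'n" where
  "real_vec \<xi> = (\<chi> i. real (\<xi> $ i))"

text \<open>The vector \<open>u = B \<xi>\<close>; vertex \<open>i\<close> has birth rate \<open>exp (u $ i)\<close>.\<close>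

definition log_birth_rate :: "real \<Rightarrow> real \<Rightarrow> ('n::finite \<Rightarrow> 'n \<Rightarrow> bool) \<Rightarrow> nat^'n \<Rightarrow> real^'n" where
  "log_birth_rate \<alpha> \<beta> E \<xi> = interaction_matrix \<alpha> \<beta> E *v real_vec \<xi>"

lemma mat_vector_mult: "mat a *v x = a *\<^sub>R (x :: real^'n)"
  by (simp add: vec_eq_iff matrix_vector_mult_def mat_def if_distrib [where f = "\<lambda>x. x * _"] sum.delta cong: if_cong)

lemma interaction_matrix_mult:
  "interaction_matrix \<alpha> \<beta> E *v x = \<alpha> *\<^sub>R x + \<beta> *\<^sub>R (adjacency_matrix E *v x)"
  by (simp add: interaction_matrix_def matrix_vector_mult_add_rdistrib mat_vector_mult scaleR_matrix_vector_assoc)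

lemma log_birth_rate_nth:
  "log_birth_rate \<alpha> \<beta> E \<xi> $ i =
    \<alpha> * real (\<xi> $ i) + \<beta> * (adjacency_matrix E *v (\<chi> j. real (\<xi> $ j))) $ i"
  by (simp add: log_birth_rate_def interaction_matrix_mult real_vec_def)

lemma real_vec_add_axis: "real_vec (\<xi> + axis i 1) = real_vec \<xi> + axis i 1"
  by (simp add: vec_eq_iff real_vec_def axis_def)

lemma real_vec_diff_axis: "0 < \<xi> $ i \<Longrightarrow> real_vec (\<xi> - axis i 1) = real_vec \<xi> - axis i 1"
  by (auto simp: vec_eq_iff real_vec_def axis_def of_nat_diff)

lemma add_axis_neq: "\<xi> + axis i (1::nat) \<noteq> \<xi>"
  by (auto simp: vec_eq_iff axis_def intro!: exI[of _ i])

lemma diff_axis_neq: "0 < \<xi> $ i \<Longrightarrow> \<xi> - axis i (1::nat) \<noteq> \<xi>"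
  by (auto simp: vec_eq_iff axis_def intro!: exI[of _ i])

definition interaction_generator ::
    "real \<Rightarrow> real \<Rightarrow> ('n::finite \<Rightarrow> 'n \<Rightarrow> bool) \<Rightarrow> (nat^'n \<Rightarrow> real) \<Rightarrow> nat^'n \<Rightarrow> real" where
  "interaction_generator \<alpha> \<beta> E f \<xi> = (\<Sum>i\<in>UNIV.
    exp (log_birth_rate \<alpha> \<beta> E \<xi> $ i) * (f (\<xi> + axis i 1) - f \<xi>) +
    (if 0 < \<xi> $ i then f (\<xi> - axis i 1) - f \<xi> else 0))"

lemma interaction_rate_eq:
  "interaction_rate \<alpha> \<beta> E \<xi> \<eta> =
    (\<Sum>i\<in>UNIV. exp (log_birth_rate \<alpha> \<beta> E \<xi> $ i) * indicator {\<xi> + axis i 1} \<eta> +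
      (if 0 < \<xi> $ i then indicator {\<xi> - axis i 1} \<eta> else 0))"
  unfolding interaction_rate_def sum.distrib log_birth_rate_nth
  by (intro arg_cong2[where f = "(+)"] sum.cong) (auto simp: indicator_def)

lemma interaction_rate_nonneg: "0 \<le> interaction_rate \<alpha> \<beta> E \<xi> \<eta>"
  unfolding interaction_rate_eq by (intro sum_nonneg) auto

lemma has_sum_sum:
  fixes f :: "'i \<Rightarrow> 'a \<Rightarrow> 'b :: {topological_comm_monoid_add, t2_space}"
  assumes "finite I" "\<And>i. i \<in> I \<Longrightarrow> (f i has_sum s i) A"
  shows "((\<lambda>x. \<Sum>i\<in>I. f i x) has_sum (\<Sum>i\<in>I. s i)) A"
  using assms by (induction I) (auto intro!: has_sum_add)

lemma exit_rate_interaction: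
  "exit_rate (interaction_rate \<alpha> \<beta> E) \<xi> =
    (\<Sum>i\<in>UNIV. exp (log_birth_rate \<alpha> \<beta> E \<xi> $ i) + (if 0 < \<xi> $ i then 1 else 0))"
proof -
  have up: "((\<lambda>\<eta>. exp (log_birth_rate \<alpha> \<beta> E \<xi> $ i) * indicator {\<xi> + axis i 1} \<eta>) has_sum
      exp (log_birth_rate \<alpha> \<beta> E \<xi> $ i)) (- {\<xi>})" for i
    by (rule has_sum_finite_neutralI[of "{\<xi> + axis i 1}"]) (auto simp: add_axis_neq simp del: One_nat_def)
  have down: "((\<lambda>\<eta>. if 0 < \<xi> $ i then indicator {\<xi> - axis i 1} \<eta> else 0) has_sum
      (if 0 < \<xi> $ i then 1 else (0::real))) (- {\<xi>})" for i
    by (rule has_sum_finite_neutralI[of "if 0 < \<xi> $ i then {\<xi> - axis i 1} else {}"])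
       (auto simp: diff_axis_neq diff_axis_neq[symmetric] simp del: One_nat_def split: if_splits)
  have "(interaction_rate \<alpha> \<beta> E \<xi> has_sum
    (\<Sum>i\<in>UNIV. exp (log_birth_rate \<alpha> \<beta> E \<xi> $ i) + (if 0 < \<xi> $ i then 1 else 0))) (- {\<xi>})"
    unfolding interaction_rate_eq[abs_def] by (intro has_sum_sum has_sum_add up down) auto
  then show ?thesis unfolding exit_rate_def by (rule infsumI)
qed

lemma nn_integral_interaction_rate:
  assumes f: "\<And>\<eta>. 0 \<le> f \<eta>"
  shows "(\<integral>\<^sup>+\<eta>. ennreal (interaction_rate \<alpha> \<beta> E \<xi> \<eta>) * ennreal (f \<eta>) \<partial>count_space (- {\<xi>})) =
    ennreal (exit_rate (interaction_rate \<alpha> \<beta> E) \<xi> * f \<xi> + interaction_generator \<alpha> \<beta> E f \<xi>)"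
proof -
  let ?u = "\<lambda>i. exp (log_birth_rate \<alpha> \<beta> E \<xi> $ i)"
  let ?up = "\<lambda>i. ?u i * f (\<xi> + axis i 1)"
    and ?down = "\<lambda>i. if 0 < \<xi> $ i then f (\<xi> - axis i 1) else 0"
  have "(\<integral>\<^sup>+\<eta>. ennreal (interaction_rate \<alpha> \<beta> E \<xi> \<eta>) * ennreal (f \<eta>) \<partial>count_space (- {\<xi>})) =
    (\<integral>\<^sup>+\<eta>. (\<Sum>i\<in>UNIV. ennreal (?up i) * indicator {\<xi> + axis i 1} \<eta>
       + ennreal (?down i) * indicator {\<xi> - axis i 1} \<eta>) \<partial>count_space (- {\<xi>}))"
  proof (intro nn_integral_cong)
    fix \<eta>
    have "ennreal (interaction_rate \<alpha> \<beta> E \<xi> \<eta>) * ennreal (f \<eta>) = ennreal (interaction_rate \<alpha> \<beta> E \<xi> \<eta> * f \<eta>)"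
      using f interaction_rate_nonneg by (intro ennreal_mult[symmetric]) auto
    also have "interaction_rate \<alpha> \<beta> E \<xi> \<eta> * f \<eta> = (\<Sum>i\<in>UNIV. ?up i * indicator {\<xi> + axis i 1} \<eta>
       + ?down i * indicator {\<xi> - axis i 1} \<eta>)"
      unfolding interaction_rate_eq sum_distrib_right by (intro sum.cong) (auto simp: indicator_def algebra_simps)
    also have "ennreal \<dots> = (\<Sum>i\<in>UNIV. ennreal (?up i * indicator {\<xi> + axis i 1} \<eta>
       + ?down i * indicator {\<xi> - axis i 1} \<eta>))"
      using f by (intro sum_ennreal[symmetric]) auto
    also have "\<dots> = (\<Sum>i\<in>UNIV. ennreal (?up i) * indicator {\<xi> + axis i 1} \<eta>
       + ennreal (?down i) * indicator {\<xi> - axis i 1} \<eta>)"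
      using f by (intro sum.cong) (auto simp: indicator_def)
    finally show "ennreal (interaction_rate \<alpha> \<beta> E \<xi> \<eta>) * ennreal (f \<eta>) = \<dots>" .
  qed
  also have "\<dots> = (\<Sum>i\<in>UNIV. (\<integral>\<^sup>+\<eta>. ennreal (?up i) * indicator {\<xi> + axis i 1} \<eta> \<partial>count_space (- {\<xi>}))
       + (\<integral>\<^sup>+\<eta>. ennreal (?down i) * indicator {\<xi> - axis i 1} \<eta> \<partial>count_space (- {\<xi>})))"
    by (simp add: nn_integral_sum nn_integral_add)
  also have "\<dots> = (\<Sum>i\<in>UNIV. ennreal (?up i) + ennreal (?down i))"
  proof (intro sum.cong refl arg_cong2[where f = "(+)"])
    fix i
    show "(\<integral>\<^sup>+\<eta>. ennreal (?up i) * indicator {\<xi> + axis i 1} \<eta> \<partial>count_space (- {\<xi>})) = ennreal (?up i)"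
      by (subst nn_integral_cmult_indicator) (auto simp: add_axis_neq simp del: One_nat_def)
    show "(\<integral>\<^sup>+\<eta>. ennreal (?down i) * indicator {\<xi> - axis i 1} \<eta> \<partial>count_space (- {\<xi>})) = ennreal (?down i)"
    proof (cases "0 < \<xi> $ i")
      case True
      then show ?thesis by (subst nn_integral_cmult_indicator) (auto simp: diff_axis_neq diff_axis_neq[symmetric] simp del: One_nat_def)
    qed simp
  qed
  also have "\<dots> = (\<Sum>i\<in>UNIV. ennreal (?up i + ?down i))"
    using f by (intro sum.cong refl ennreal_plus[symmetric]) auto
  also have "\<dots> = ennreal (\<Sum>i\<in>UNIV. ?up i + ?down i)"
    using f by (intro sum_ennreal) auto
  also have "(\<Sum>i\<in>UNIV. ?up i + ?down i) =
      exit_rate (interaction_rate \<alpha> \<beta> E) \<xi> * f \<xi> + interaction_generator \<alpha> \<beta> E f \<xi>"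
    unfolding exit_rate_interaction interaction_generator_def sum_distrib_right sum.distrib[symmetric]
    by (intro sum.cong) (auto simp: algebra_simps)
  finally show ?thesis .
qed

lemma regular_ctmc_interaction:
  assumes "ctmc M (interaction_rate \<alpha> \<beta> E) Y S"
  shows "regular_ctmc M (interaction_rate \<alpha> \<beta> E) Y S"
proof -
  interpret ctmc M "interaction_rate \<alpha> \<beta> E" Y S by fact
  show ?thesis
  proof
    show "0 < exit_rate (interaction_rate \<alpha> \<beta> E) \<xi>" for \<xi>
      unfolding exit_rate_interaction by (intro sum_pos add_pos_nonneg) auto
  qed (rule interaction_rate_nonneg)
qed

section \<open>The critical interaction matrix\<close>

lemma transpose_adjacency_matrix:
  "simple_graph E \<Longrightarrow> transpose (adjacency_matrix E) = adjacency_matrix E"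
  by (auto simp: simple_graph_def symp_def transpose_def adjacency_matrix_def vec_eq_iff)

lemma transpose_interaction_matrix:
  "simple_graph E \<Longrightarrow> transpose (interaction_matrix \<alpha> \<beta> E) = interaction_matrix \<alpha> \<beta> E"
  using transpose_adjacency_matrix[of E]
  by (auto simp: interaction_matrix_def transpose_def mat_def vec_eq_iff)

lemma interaction_matrix_nth:
  assumes "simple_graph E"
  shows "interaction_matrix \<alpha> \<beta> E $ i $ j = (if i = j then \<alpha> else if E i j then \<beta> else 0)"
  using assms by (auto simp: interaction_matrix_def mat_def adjacency_matrix_def simple_graph_def irreflp_def)

lemma log_birth_rate_add_axis:
  "log_birth_rate \<alpha> \<beta> E (\<xi> + axis i 1) $ j = log_birth_rate \<alpha> \<beta> E \<xi> $ j + interaction_matrix \<alpha> \<beta> E $ j $ i"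
  by (simp add: log_birth_rate_def real_vec_add_axis matrix_vector_right_distrib matrix_vector_mult_basis column_def del: One_nat_def)

lemma log_birth_rate_diff_axis:
  "0 < \<xi> $ i \<Longrightarrow>
    log_birth_rate \<alpha> \<beta> E (\<xi> - axis i 1) $ j = log_birth_rate \<alpha> \<beta> E \<xi> $ j - interaction_matrix \<alpha> \<beta> E $ j $ i"
  by (simp add: log_birth_rate_def real_vec_diff_axis matrix_vector_mult_diff_distrib matrix_vector_mult_basis column_def del: One_nat_def)

text \<open>The form of the adjacency matrix vanishes at unit coordinate vectors, so its top eigenvalue is
  nonnegative, and the critical relation with \<open>\<alpha> < 0\<close> forces \<open>\<beta> > 0\<close>. Hence the top of the spectrum of
  \<open>B\<close> is \<open>\<alpha> + \<beta> \<lambda> = 0\<close>, with the same eigenvector.\<close>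

lemma interaction_matrix_degenerate:
  assumes E: "simple_graph E" and "\<alpha> < 0" and crit: "\<alpha> + \<beta> * largest_eigenvalue (adjacency_matrix E) = 0"
  obtains v where "norm v = 1" "\<And>i. 0 \<le> v $ i" "interaction_matrix \<alpha> \<beta> E *v v = 0"
    and "0 < \<beta>" "\<And>x. x \<bullet> (interaction_matrix \<alpha> \<beta> E *v x) \<le> 0"
proof -
  let ?A = "adjacency_matrix E" and ?l = "largest_eigenvalue (adjacency_matrix E)"
  have "0 \<le> ?A $ i $ j" for i j by (simp add: adjacency_matrix_def)
  from nonneg_top_eigenvector[OF transpose_adjacency_matrix[OF E] this]
  obtain v where v: "norm v = 1" "\<And>i. 0 \<le> v $ i" "?A *v v = ?l *\<^sub>R v"
    and le: "\<And>x. x \<bullet> (?A *v x) \<le> ?l * (x \<bullet> x)" by blast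
  have "axis undefined 1 \<bullet> (?A *v axis undefined 1) = 0"
    using E by (simp add: inner_axis' matrix_vector_mult_basis column_def adjacency_matrix_def simple_graph_def irreflp_def)
  then have "0 \<le> ?l" using le[of "axis undefined 1"] by (simp add: inner_axis_axis)
  moreover have "0 < \<beta> * ?l" using crit \<open>\<alpha> < 0\<close> by simp
  ultimately have b: "0 < \<beta>" by (simp add: zero_less_mult_iff)
  have "x \<bullet> (interaction_matrix \<alpha> \<beta> E *v x) \<le> 0" for x
  proof -
    have "x \<bullet> (interaction_matrix \<alpha> \<beta> E *v x) = \<alpha> * (x \<bullet> x) + \<beta> * (x \<bullet> (?A *v x))"
      by (simp add: interaction_matrix_mult inner_add_right)
    also have "\<dots> \<le> \<alpha> * (x \<bullet> x) + \<beta> * (?l * (x \<bullet> x))"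
      using le b by (intro add_left_mono mult_left_mono) auto
    also have "\<dots> = (\<alpha> + \<beta> * ?l) * (x \<bullet> x)" by (simp add: algebra_simps)
    finally show ?thesis by (simp add: crit)
  qed
  moreover have "interaction_matrix \<alpha> \<beta> E *v v = (\<alpha> + \<beta> * ?l) *\<^sub>R v"
    by (simp add: interaction_matrix_mult v scaleR_add_left)
  ultimately show ?thesis using that[of v] v b crit by simp
qed

section \<open>Non-explosion: the energy\<close>

text \<open>The contribution of one vertex to the drift of the energy: a birth, at rate \<open>exp u\<close>, changes the
  energy by \<open>c - u\<close>, and a death, at rate \<open>1\<close>, changes it by \<open>c + u\<close>. For large \<open>u\<close> the births win.\<close>

lemma birth_death_energy_drift_le:
  fixes u c :: real
  assumes "0 \<le> c"
  shows "exp u * (c - u) + (if b then u + c else 0) \<le> exp c + 2 * c + 1"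
proof -
  have ec: "1 \<le> exp c" using assms by simp
  have *: "exp u * (c - u) \<le> exp c"
  proof -
    have "c - u \<le> exp (c - u)" using exp_ge_add_one_self[of "c - u"] by linarith
    then have "exp u * (c - u) \<le> exp u * exp (c - u)" by (intro mult_left_mono) auto
    then show ?thesis by (simp add: exp_add[symmetric])
  qed
  show ?thesis
  proof (cases "u \<le> c + 1")
    case True
    then show ?thesis using * assms by (auto split: if_splits)
  next
    case False
    have "exp u * (c - u) \<le> exp u * (- 1)" using False by (intro mult_left_mono) auto
    also have "\<dots> \<le> - (1 + u)" using exp_ge_add_one_self[of u] by linarith
    finally have "exp u * (c - u) \<le> - (1 + u)" .
    moreover have "(if b then u + c else 0) \<le> u + c" using assms False by simp
    ultimately show ?thesis using assms ec by linarith
  qed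
qed

text \<open>The function is \<open>f = 1 + U\<close> with the energy \<open>U = - (\<xi> \<bullet> B \<xi>) / 2 \<ge> 0\<close>, up to a linear term minus the
  logarithm of the reversible measure of the chain. It does not tend to infinity (it is bounded along the kernel
  of \<open>B\<close>), but Cauchy-Schwarz gives \<open>u\<^sub>i\<^sup>2 \<le> 4 c U\<close>, so the rates are bounded where \<open>U\<close> is.\<close>

lemma non_explosive_interaction:
  fixes E :: "'n::finite \<Rightarrow> 'n \<Rightarrow> bool"
  assumes E: "simple_graph E" and chain: "ctmc M (interaction_rate \<alpha> \<beta> E) Y S"
    and "\<alpha> < 0" and neg: "\<And>x. x \<bullet> (interaction_matrix \<alpha> \<beta> E *v x) \<le> 0"
  shows "non_explosive M S"
proof -
  interpret regular_ctmc M "interaction_rate \<alpha> \<beta> E" Y S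
    by (rule regular_ctmc_interaction) fact
  let ?B = "interaction_matrix \<alpha> \<beta> E" and ?u = "log_birth_rate \<alpha> \<beta> E"
  note sym = transpose_interaction_matrix[OF E, of \<alpha> \<beta>]
  define c where "c = - \<alpha> / 2"
  have c: "0 < c" using \<open>\<alpha> < 0\<close> by (simp add: c_def)
  define U where "U x = - (x \<bullet> (?B *v x)) / 2" for x
  have U_nonneg: "0 \<le> U x" for x using neg[of x] by (simp add: U_def)
  have U_shift: "U (x + t *\<^sub>R axis i 1) = U x - t * (?B *v x) $ i + t\<^sup>2 * c" for x t i
    unfolding U_def quadratic_form_add[OF sym]
    by (simp add: inner_axis' matrix_vector_mult_basis column_def interaction_matrix_nth[OF E] c_def field_simps)
  define f where "f \<xi> = 1 + U (real_vec \<xi>)" for \<xi> :: "nat^'n"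
  have f1: "1 \<le> f \<xi>" for \<xi> using U_nonneg by (simp add: f_def)
  have f_up: "f (\<xi> + axis i 1) - f \<xi> = c - ?u \<xi> $ i" for \<xi> i
    using U_shift[of "real_vec \<xi>" 1 i] by (simp add: f_def real_vec_add_axis log_birth_rate_def del: One_nat_def)
  have f_down: "f (\<xi> - axis i 1) - f \<xi> = ?u \<xi> $ i + c" if "0 < \<xi> $ i" for \<xi> i
    using U_shift[of "real_vec \<xi>" "-1" i] that by (simp add: f_def real_vec_diff_axis log_birth_rate_def del: One_nat_def)
  \<comment> \<open>semidefiniteness along the line through \<open>\<xi>\<close> in direction \<open>i\<close> bounds the slope \<open>u\<^sub>i\<close> of the energy\<close>
  have u_le: "?u \<xi> $ i \<le> 1 + 4 * c * f \<xi>" for \<xi> i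
  proof -
    have "0 \<le> U (real_vec \<xi>) + 2 * t * (- ?u \<xi> $ i / 2) + t\<^sup>2 * c" for t
      using U_nonneg[of "real_vec \<xi> + t *\<^sub>R axis i 1"] by (simp add: U_shift log_birth_rate_def)
    from discriminant_le_if_quadratic_nonneg[OF this] c
    have "(?u \<xi> $ i)\<^sup>2 \<le> 4 * c * U (real_vec \<xi>)" by (simp add: power_divide mult_ac)
    also have "\<dots> \<le> 4 * c * f \<xi>" using c by (simp add: f_def)
    finally have "(?u \<xi> $ i)\<^sup>2 \<le> 4 * c * f \<xi>" .
    moreover have "?u \<xi> $ i \<le> 1 + (?u \<xi> $ i)\<^sup>2"
      using zero_le_power2[of "?u \<xi> $ i - 1"] zero_le_power2[of "?u \<xi> $ i + 1"] by (simp add: power2_eq_square algebra_simps)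
    ultimately show ?thesis by simp
  qed
  define K where "K = real CARD('n) * (exp c + 2 * c + 1)"
  have K: "0 < K" unfolding K_def using c by (intro mult_pos_pos add_pos_pos) auto
  have drift: "interaction_generator \<alpha> \<beta> E f \<xi> \<le> K * f \<xi>" for \<xi>
  proof -
    have "interaction_generator \<alpha> \<beta> E f \<xi> =
        (\<Sum>i\<in>UNIV. exp (?u \<xi> $ i) * (c - ?u \<xi> $ i) + (if 0 < \<xi> $ i then ?u \<xi> $ i + c else 0))"
      unfolding interaction_generator_def f_up by (intro sum.cong) (auto simp: f_down simp del: One_nat_def)
    also have "\<dots> \<le> (\<Sum>i\<in>(UNIV :: 'n set). exp c + 2 * c + 1)"
      using c by (intro sum_mono birth_death_energy_drift_le) auto
    also have "\<dots> = K" by (simp add: K_def)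
    also have "\<dots> \<le> K * f \<xi>" using K f1[of \<xi>] by simp
    finally show ?thesis .
  qed
  show ?thesis
  proof (rule non_explosive_if_drift_le[OF K])
    show f0: "0 \<le> f \<xi>" for \<xi> using f1[of \<xi>] by simp
    show "(\<integral>\<^sup>+\<eta>. ennreal (interaction_rate \<alpha> \<beta> E \<xi> \<eta>) * ennreal (f \<eta>) \<partial>count_space (- {\<xi>}))
        \<le> ennreal ((exit_rate (interaction_rate \<alpha> \<beta> E) \<xi> + K) * f \<xi>)" for \<xi>
      unfolding nn_integral_interaction_rate[OF f0] using drift[of \<xi>]
      by (intro ennreal_leI) (simp add: distrib_right)
    show "\<exists>R. \<forall>\<xi>. f \<xi> < b \<longrightarrow> exit_rate (interaction_rate \<alpha> \<beta> E) \<xi> \<le> R" for b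
    proof (intro exI allI impI)
      fix \<xi> assume "f \<xi> < b"
      then have "?u \<xi> $ i \<le> 1 + 4 * c * b" for i
        using u_le[of \<xi> i] c mult_left_mono[of "f \<xi>" b "4 * c"] by linarith
      then show "exit_rate (interaction_rate \<alpha> \<beta> E) \<xi> \<le> (\<Sum>i\<in>(UNIV :: 'n set). exp (1 + 4 * c * b) + 1)"
        unfolding exit_rate_interaction by (intro sum_mono add_mono) auto
    qed
  qed
qed

section \<open>Transience: a function with negative drift\<close>

lemma exp_minus_le:
  fixes x :: real
  assumes "0 \<le> x"
  shows "exp (- x) \<le> 1 - x + x\<^sup>2"
proof -
  have "exp (- x) \<le> 1 / (1 + x)"
    using exp_ge_add_one_self[of x] assms by (simp add: exp_minus field_simps)
  also have "\<dots> \<le> 1 - x + x\<^sup>2"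
  proof -
    have "1 \<le> (1 - x + x\<^sup>2) * (1 + x)"
      using assms by (simp add: algebra_simps power2_eq_square)
    then show ?thesis using assms by (simp add: field_simps)
  qed
  finally show ?thesis .
qed

text \<open>The relative change of the function used for transience caused by one vertex, at a state near balance;
  here \<open>x = d v\<^sub>i\<close>. Leaving the region near balance costs the chain the factor \<open>1 + 2 d\<^sup>2\<close>, which beats the error
  of second order in \<open>exp (- x)\<close> and \<open>exp x\<close>. The flag \<open>b\<close> tells whether a death is possible.\<close>

lemma drift_at_balance_le:
  fixes u x d :: real
  assumes x: "0 \<le> x" "x \<le> d" and d: "d \<le> 1"
  shows "exp u * (exp (- x) - (1 + 2 * d\<^sup>2)) + (if b then exp x - (1 + 2 * d\<^sup>2) else 0)
    \<le> - x * u - d\<^sup>2 * exp u"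
proof -
  have xd: "x\<^sup>2 \<le> d\<^sup>2" using x by (intro power_mono)
  have "exp (- x) - (1 + 2 * d\<^sup>2) \<le> - x - d\<^sup>2" using exp_minus_le[OF x(1)] xd by linarith
  then have "exp u * (exp (- x) - (1 + 2 * d\<^sup>2)) \<le> exp u * (- x - d\<^sup>2)"
    by (intro mult_left_mono) auto
  moreover have "(if b then exp x - (1 + 2 * d\<^sup>2) else 0) \<le> x"
  proof -
    have "exp x \<le> 1 + x + x\<^sup>2" using x d by (intro exp_bound) auto
    then have "exp x - (1 + 2 * d\<^sup>2) \<le> x" using xd zero_le_power2[of d] by linarith
    then show ?thesis using x by simp
  qed
  moreover have "x * (1 + u) \<le> x * exp u" using x by (intro mult_left_mono) auto
  ultimately show ?thesis by (simp add: algebra_simps)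
qed

text \<open>The same at a state away from balance, in the worst case where every jump gains the factor
  \<open>1 + 2 d\<^sup>2\<close>: the loss is of order \<open>d\<^sup>2\<close> times the jump rate.\<close>

lemma drift_off_balance_le:
  fixes u x d :: real
  assumes x: "0 \<le> x" "x \<le> d" and d: "d \<le> 1"
  shows "exp u * (exp (- x) * (1 + 2 * d\<^sup>2) - 1) + (if b then exp x * (1 + 2 * d\<^sup>2) - 1 else 0)
    \<le> - x * (exp u - 1) + 7 * d\<^sup>2 * (exp u + 1)"
proof -
  have xd: "x\<^sup>2 \<le> d\<^sup>2" using x by (intro power_mono)
  have "exp (- x) * (2 * d\<^sup>2) \<le> 1 * (2 * d\<^sup>2)" using x by (intro mult_right_mono) auto
  then have "exp (- x) * (1 + 2 * d\<^sup>2) - 1 \<le> - x + 7 * d\<^sup>2"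
    using exp_minus_le[OF x(1)] xd zero_le_power2[of d] unfolding distrib_left mult_1_right by linarith
  then have "exp u * (exp (- x) * (1 + 2 * d\<^sup>2) - 1) \<le> exp u * (- x + 7 * d\<^sup>2)"
    by (intro mult_left_mono) auto
  moreover have "(if b then exp x * (1 + 2 * d\<^sup>2) - 1 else 0) \<le> x + 7 * d\<^sup>2"
  proof -
    have e: "exp x \<le> 1 + x + x\<^sup>2" using x d by (intro exp_bound) auto
    have "x\<^sup>2 \<le> 1" using x d by (intro power_le_one) auto
    then have "exp x * (2 * d\<^sup>2) \<le> 3 * (2 * d\<^sup>2)" using e x d by (intro mult_right_mono) auto
    then have "exp x * (1 + 2 * d\<^sup>2) - 1 \<le> x + 7 * d\<^sup>2"
      using e xd by (simp add: distrib_left)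
    then show ?thesis using x by simp
  qed
  ultimately show ?thesis by (simp add: algebra_simps)
qed

text \<open>Quantifies the strict convexity of \<open>exp\<close>: away from \<open>u = 0\<close> the drift of \<open>v \<bullet> \<xi>\<close> is
  bounded below.\<close>

lemma exp_excess_ge:
  fixes u :: real
  shows "min 1 (u\<^sup>2 / 4) \<le> exp u - 1 - u"
proof (cases "- 2 \<le> u")
  case True
  have "(1 + u / 2)\<^sup>2 \<le> (exp (u / 2))\<^sup>2"
    using True exp_ge_add_one_self[of "u / 2"] by (intro power_mono) auto
  also have "\<dots> = exp u" by (simp add: power2_eq_square exp_add[symmetric])
  finally have "u\<^sup>2 / 4 \<le> exp u - 1 - u" by (simp add: power2_eq_square algebra_simps)
  then show ?thesis by simp
next
  case False
  have "0 < exp u" by simp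
  then have "1 \<le> exp u - 1 - u" using False by linarith
  then show ?thesis by simp
qed

text \<open>For large \<open>u\<close> the excess is comparable to the jump rate \<open>exp u + 1\<close>, so errors proportional to the
  rate can be absorbed.\<close>

lemma exp_add_one_le_excess:
  fixes u :: real
  shows "exp u + 1 \<le> 2 * (exp u - 1 - u) + 3"
proof -
  have "2 * u \<le> exp u"
  proof (cases "0 \<le> u")
    case True
    have "2 * u \<le> (1 + u / 2)\<^sup>2"
      using zero_le_power2[of "1 - u / 2"] by (simp add: power2_eq_square algebra_simps)
    also have "\<dots> \<le> (exp (u / 2))\<^sup>2"
      using True exp_ge_add_one_self[of "u / 2"] by (intro power_mono) auto
    also have "\<dots> = exp u" by (simp add: power2_eq_square exp_add[symmetric])
    finally show ?thesis .
  next
    case False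
    then show ?thesis using exp_gt_zero[of u] by linarith
  qed
  then show ?thesis by simp
qed

text \<open>The function with strictly negative drift is \<open>exp (- d (v \<bullet> \<xi>))\<close>, enlarged by the factor \<open>1 + 2 d\<^sup>2\<close> where
  \<open>\<bar>u\<^sub>i\<bar> < r\<close> for all \<open>i\<close> in the support \<open>I\<close> of \<open>v\<close>. Since \<open>v\<close> is a nonnegative null vector of \<open>B\<close>, no
  edge joins \<open>I\<close> to its complement, so jumps outside \<open>I\<close> leave this function unchanged. With
  \<open>\<bar>\<alpha>\<bar> = 2 r\<close>, each jump at a vertex of \<open>I\<close> leads out of the region where the factor is present.\<close>

lemma transient_interaction:
  fixes E :: "'n::finite \<Rightarrow> 'n \<Rightarrow> bool"
  assumes E: "simple_graph E" and chain: "ctmc M (interaction_rate \<alpha> \<beta> E) Y S"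
    and "\<alpha> < 0" "0 < \<beta>"
    and v1: "norm v = 1" and v0: "\<And>i. 0 \<le> v $ i" and Bv: "interaction_matrix \<alpha> \<beta> E *v v = 0"
  shows "transient M (chain_at Y S)"
proof -
  interpret regular_ctmc M "interaction_rate \<alpha> \<beta> E" Y S
    by (rule regular_ctmc_interaction) fact
  let ?B = "interaction_matrix \<alpha> \<beta> E" and ?u = "log_birth_rate \<alpha> \<beta> E"
  define I where "I = {i. 0 < v $ i}"
  have vI: "v $ i = 0" if "i \<notin> I" for i using that v0[of i] by (simp add: I_def)
  have v_le: "v $ i \<le> 1" for i using component_le_norm_cart[of v i] v0[of i] v1 by simp
  have "I \<noteq> {}"
  proof
    assume "I = {}"
    then have "v = 0" using vI by (simp add: vec_eq_iff)
    then show False using v1 by simp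
  qed
  \<comment> \<open>in row \<open>j\<close> of \<open>B v = 0\<close> the diagonal term vanishes and the others are nonnegative\<close>
  have no_edge: "?B $ i $ j = 0" if "i \<in> I" "j \<notin> I" for i j
  proof -
    have "(\<Sum>k\<in>UNIV. ?B $ j $ k * v $ k) = 0"
      using Bv by (simp add: vec_eq_iff matrix_vector_mult_def)
    moreover have "0 \<le> ?B $ j $ k * v $ k" for k
      using vI[OF that(2)] v0[of k] \<open>0 < \<beta>\<close> by (auto simp: interaction_matrix_nth[OF E])
    ultimately have "?B $ j $ i * v $ i = 0" by (subst (asm) sum_nonneg_eq_0_iff) auto
    then have "?B $ j $ i = 0" using that by (simp add: I_def)
    moreover have "?B $ i $ j = ?B $ j $ i"
      using E by (auto simp: interaction_matrix_nth[OF E] simple_graph_def symp_def)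
    ultimately show ?thesis by simp
  qed
  have balance: "(\<Sum>i\<in>I. v $ i * ?u \<xi> $ i) = 0" for \<xi>
  proof -
    have "(\<Sum>i\<in>I. v $ i * ?u \<xi> $ i) = (\<Sum>i\<in>UNIV. v $ i * ?u \<xi> $ i)"
      using vI by (intro sum.mono_neutral_left) auto
    also have "\<dots> = v \<bullet> (?B *v real_vec \<xi>)" by (simp add: inner_vec_def log_birth_rate_def)
    also have "\<dots> = 0"
      by (simp add: inner_symmetric_matrix[OF transpose_interaction_matrix[OF E], of v] Bv)
    finally show ?thesis .
  qed

  define r where "r = - \<alpha> / 2"
  define g where "g = min 1 (r\<^sup>2 / 4)"
  define w where "w = Min ((\<lambda>i. v $ i) ` I)"
  have r: "0 < r" using \<open>\<alpha> < 0\<close> by (simp add: r_def)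
  have g: "0 < g" using r by (simp add: g_def)
  have w: "0 < w" "\<And>i. i \<in> I \<Longrightarrow> w \<le> v $ i"
    using \<open>I \<noteq> {}\<close> by (auto simp: w_def I_def Min_gr_iff)
  define C where "C = 2 + 3 * real (card I) / g"
  have C: "0 < C" using g by (simp add: C_def add_pos_nonneg)
  \<comment> \<open>small enough for the gain, at least \<open>d w\<close> times the excess, to beat the loss of at most \<open>7 d\<^sup>2 C\<close> times the excess\<close>
  define d where "d = min 1 (w / (8 * C))"
  have d: "0 < d" "d \<le> 1" "7 * d * C < w"
  proof -
    show "0 < d" "d \<le> 1" using w C by (simp_all add: d_def)
    have "d * (8 * C) \<le> w" using C by (simp add: d_def min_def field_simps)
    moreover have "0 < d * C" using \<open>0 < d\<close> C by simp
    ultimately show "7 * d * C < w" by simp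
  qed

  define near where "near \<xi> \<longleftrightarrow> (\<forall>i\<in>I. \<bar>?u \<xi> $ i\<bar> < r)" for \<xi>
  define F where "F \<xi> = exp (- d * (v \<bullet> real_vec \<xi>))" for \<xi>
  define f where "f \<xi> = F \<xi> * (if near \<xi> then 1 + 2 * d\<^sup>2 else 1)" for \<xi>
  have F_pos: "0 < F \<xi>" for \<xi> by (simp add: F_def)
  have F_up: "F (\<xi> + axis i 1) = F \<xi> * exp (- (d * v $ i))" for \<xi> i
    by (simp add: F_def real_vec_add_axis inner_add_right inner_axis exp_add[symmetric] algebra_simps del: One_nat_def)
  have F_down: "F (\<xi> - axis i 1) = F \<xi> * exp (d * v $ i)" if "0 < \<xi> $ i" for \<xi> i
    using that by (simp add: F_def real_vec_diff_axis inner_diff_right inner_axis exp_add[symmetric] algebra_simps del: One_nat_def)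
  have f_le: "f \<xi> \<le> F \<xi> * (1 + 2 * d\<^sup>2)" for \<xi>
    using F_pos[of \<xi>] unfolding f_def by (intro mult_left_mono) auto
  have far_up: "\<not> near (\<xi> + axis i 1)" if "near \<xi>" "i \<in> I" for \<xi> i
  proof
    assume "near (\<xi> + axis i 1)"
    then have "\<bar>?u \<xi> $ i + \<alpha>\<bar> < r"
      using \<open>i \<in> I\<close> by (auto simp: near_def log_birth_rate_add_axis interaction_matrix_nth[OF E] simp del: One_nat_def)
    then show False using that by (auto simp: near_def r_def)
  qed
  have far_down: "\<not> near (\<xi> - axis i 1)" if "near \<xi>" "i \<in> I" "0 < \<xi> $ i" for \<xi> i
  proof
    assume "near (\<xi> - axis i 1)"
    then have "\<bar>?u \<xi> $ i - \<alpha>\<bar> < r"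
      using that by (auto simp: near_def log_birth_rate_diff_axis interaction_matrix_nth[OF E] simp del: One_nat_def)
    then show False using that by (auto simp: near_def r_def)
  qed
  have off_up: "f (\<xi> + axis i 1) = f \<xi>" if "i \<notin> I" for \<xi> i
    using that by (simp add: f_def F_up vI near_def log_birth_rate_add_axis no_edge del: One_nat_def)
  have off_down: "f (\<xi> - axis i 1) = f \<xi>" if "i \<notin> I" "0 < \<xi> $ i" for \<xi> i
    using that by (simp add: f_def F_down vI near_def log_birth_rate_diff_axis no_edge del: One_nat_def)

  have drift: "interaction_generator \<alpha> \<beta> E f \<xi> < 0" for \<xi>
  proof -
    let ?t = "\<lambda>i. exp (?u \<xi> $ i) * (f (\<xi> + axis i 1) - f \<xi>) +
      (if 0 < \<xi> $ i then f (\<xi> - axis i 1) - f \<xi> else 0)"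
    have gen: "interaction_generator \<alpha> \<beta> E f \<xi> = (\<Sum>i\<in>I. ?t i)"
      unfolding interaction_generator_def
      by (intro sum.mono_neutral_right) (auto simp: off_up off_down simp del: One_nat_def)
    have x: "0 \<le> d * v $ i" "d * v $ i \<le> d" for i
      using d v0[of i] v_le[of i] by (auto simp: mult_left_le)
    show ?thesis
    proof (cases "near \<xi>")
      case True
      have "?t i \<le> F \<xi> * (- (d * v $ i) * ?u \<xi> $ i - d\<^sup>2 * exp (?u \<xi> $ i))" if "i \<in> I" for i
      proof -
        have "?t i = F \<xi> * (exp (?u \<xi> $ i) * (exp (- (d * v $ i)) - (1 + 2 * d\<^sup>2)) +
            (if 0 < \<xi> $ i then exp (d * v $ i) - (1 + 2 * d\<^sup>2) else 0))"
          using True that far_up far_down by (simp add: f_def F_up F_down algebra_simps del: One_nat_def)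
        also have "\<dots> \<le> F \<xi> * (- (d * v $ i) * ?u \<xi> $ i - d\<^sup>2 * exp (?u \<xi> $ i))"
          using F_pos[of \<xi>] x d by (intro mult_left_mono drift_at_balance_le) auto
        finally show ?thesis .
      qed
      then have "(\<Sum>i\<in>I. ?t i) \<le> (\<Sum>i\<in>I. F \<xi> * (- (d * v $ i) * ?u \<xi> $ i - d\<^sup>2 * exp (?u \<xi> $ i)))"
        by (rule sum_mono)
      also have "\<dots> = F \<xi> * (- d * (\<Sum>i\<in>I. v $ i * ?u \<xi> $ i) - d\<^sup>2 * (\<Sum>i\<in>I. exp (?u \<xi> $ i)))"
        by (simp add: sum_distrib_left sum_subtractf[symmetric] algebra_simps)
      also have "\<dots> = - (F \<xi> * d\<^sup>2 * (\<Sum>i\<in>I. exp (?u \<xi> $ i)))" by (simp add: balance)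
      also have "\<dots> < 0"
        using F_pos[of \<xi>] d \<open>I \<noteq> {}\<close> by (auto intro!: mult_pos_pos sum_pos)
      finally show ?thesis unfolding gen .
    next
      case False
      let ?g = "\<lambda>i. exp (?u \<xi> $ i) - 1 - ?u \<xi> $ i"
      have g0: "0 \<le> ?g i" for i using exp_ge_add_one_self[of "?u \<xi> $ i"] by linarith
      obtain k where k: "k \<in> I" "r \<le> \<bar>?u \<xi> $ k\<bar>" using False by (auto simp: near_def not_less)
      have "r\<^sup>2 \<le> (?u \<xi> $ k)\<^sup>2" using k r by (simp add: abs_le_square_iff[symmetric])
      then have "g \<le> min 1 ((?u \<xi> $ k)\<^sup>2 / 4)" by (auto simp: g_def)
      also have "\<dots> \<le> ?g k" by (rule exp_excess_ge)
      also have "\<dots> \<le> (\<Sum>i\<in>I. ?g i)" using k g0 by (intro member_le_sum) auto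
      finally have G: "g \<le> (\<Sum>i\<in>I. ?g i)" .
      have "?t i \<le> F \<xi> * (- (d * w) * ?g i - d * (v $ i * ?u \<xi> $ i) + 7 * d\<^sup>2 * (2 * ?g i + 3))" if "i \<in> I" for i
      proof -
        have "exp (?u \<xi> $ i) * (f (\<xi> + axis i 1) - f \<xi>) \<le>
            exp (?u \<xi> $ i) * (F \<xi> * exp (- (d * v $ i)) * (1 + 2 * d\<^sup>2) - F \<xi>)"
          using f_le[of "\<xi> + axis i 1"] False by (intro mult_left_mono) (auto simp: F_up f_def[of \<xi>] simp del: One_nat_def)
        moreover have "(if 0 < \<xi> $ i then f (\<xi> - axis i 1) - f \<xi> else 0) \<le>
            (if 0 < \<xi> $ i then F \<xi> * exp (d * v $ i) * (1 + 2 * d\<^sup>2) - F \<xi> else 0)"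
          using f_le[of "\<xi> - axis i 1"] False by (auto simp: F_down f_def[of \<xi>] simp del: One_nat_def)
        ultimately have "?t i \<le> F \<xi> * (exp (?u \<xi> $ i) * (exp (- (d * v $ i)) * (1 + 2 * d\<^sup>2) - 1) +
            (if 0 < \<xi> $ i then exp (d * v $ i) * (1 + 2 * d\<^sup>2) - 1 else 0))"
          by (simp add: algebra_simps del: One_nat_def split: if_splits)
        also have "\<dots> \<le> F \<xi> * (- (d * v $ i) * (exp (?u \<xi> $ i) - 1) + 7 * d\<^sup>2 * (exp (?u \<xi> $ i) + 1))"
          using F_pos[of \<xi>] x d by (intro mult_left_mono drift_off_balance_le) auto
        also have "\<dots> \<le> F \<xi> * (- (d * w) * ?g i - d * (v $ i * ?u \<xi> $ i) + 7 * d\<^sup>2 * (2 * ?g i + 3))"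
        proof (intro mult_left_mono)
          have "d * w * ?g i \<le> d * v $ i * ?g i"
            using w(2)[OF that] d g0[of i] by (intro mult_right_mono mult_left_mono) auto
          moreover have "7 * d\<^sup>2 * (exp (?u \<xi> $ i) + 1) \<le> 7 * d\<^sup>2 * (2 * ?g i + 3)"
            by (intro mult_left_mono exp_add_one_le_excess) auto
          ultimately show "- (d * v $ i) * (exp (?u \<xi> $ i) - 1) + 7 * d\<^sup>2 * (exp (?u \<xi> $ i) + 1)
              \<le> - (d * w) * ?g i - d * (v $ i * ?u \<xi> $ i) + 7 * d\<^sup>2 * (2 * ?g i + 3)"
            by (simp add: algebra_simps)
        qed (use F_pos[of \<xi>] in simp)
        finally show ?thesis .
      qed
      then have "(\<Sum>i\<in>I. ?t i) \<le>
          (\<Sum>i\<in>I. F \<xi> * (- (d * w) * ?g i - d * (v $ i * ?u \<xi> $ i) + 7 * d\<^sup>2 * (2 * ?g i + 3)))"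
        by (rule sum_mono)
      also have "\<dots> = F \<xi> * (- (d * w) * (\<Sum>i\<in>I. ?g i) - d * (\<Sum>i\<in>I. v $ i * ?u \<xi> $ i)
          + 7 * d\<^sup>2 * (2 * (\<Sum>i\<in>I. ?g i) + 3 * real (card I)))"
      proof -
        have "(\<Sum>i\<in>I. 2 * ?g i + 3) = 2 * (\<Sum>i\<in>I. ?g i) + 3 * real (card I)"
          by (simp only: sum.distrib sum_distrib_left sum_constant mult.commute)
        then show ?thesis
          by (simp only: sum_distrib_left[symmetric] sum.distrib sum_subtractf)
      qed
      also have "\<dots> \<le> F \<xi> * (- (d * w) * (\<Sum>i\<in>I. ?g i) + 7 * d\<^sup>2 * (C * (\<Sum>i\<in>I. ?g i)))"
      proof -
        have "3 * real (card I) / g * g \<le> 3 * real (card I) / g * (\<Sum>i\<in>I. ?g i)"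
          using G g by (intro mult_left_mono) auto
        then have "2 * (\<Sum>i\<in>I. ?g i) + 3 * real (card I) \<le> C * (\<Sum>i\<in>I. ?g i)"
          using g unfolding C_def distrib_right by simp
        then have "7 * d\<^sup>2 * (2 * (\<Sum>i\<in>I. ?g i) + 3 * real (card I)) \<le> 7 * d\<^sup>2 * (C * (\<Sum>i\<in>I. ?g i))"
          by (intro mult_left_mono) auto
        then show ?thesis using F_pos[of \<xi>] unfolding balance by (intro mult_left_mono) auto
      qed
      also have "\<dots> = F \<xi> * d * (\<Sum>i\<in>I. ?g i) * (7 * d * C - w)"
        by (simp only: power2_eq_square) (simp add: algebra_simps)
      also have "\<dots> < 0"
        using F_pos[of \<xi>] d g G by (intro mult_pos_neg mult_pos_pos) auto
      finally show ?thesis unfolding gen .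
    qed
  qed

  show ?thesis
  proof (rule transient_if_drift_neg)
    have f_pos: "0 < f \<xi>" for \<xi> using F_pos[of \<xi>] by (auto simp: f_def intro!: mult_pos_pos add_pos_nonneg)
    then show f0: "0 \<le> f \<xi>" for \<xi> by (simp add: less_imp_le)
    show "(\<integral>\<^sup>+\<eta>. ennreal (interaction_rate \<alpha> \<beta> E \<xi> \<eta>) * ennreal (f \<eta>) \<partial>count_space (- {\<xi>}))
        < ennreal (exit_rate (interaction_rate \<alpha> \<beta> E) \<xi> * f \<xi>)" for \<xi>
      unfolding nn_integral_interaction_rate[OF f0] using drift[of \<xi>] exit_rate_pos[of \<xi>] f_pos[of \<xi>]
      by (intro ennreal_lessI) auto
  qed
qed

section \<open>Transience and non-explosion at criticality\<close>

theorem lemma6p3: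
  fixes E :: "'n::finite \<Rightarrow> 'n \<Rightarrow> bool"
    and \<alpha> \<beta> :: real
    and M :: "'w measure"
    and Y :: "nat \<Rightarrow> 'w \<Rightarrow> nat^'n"
    and S :: "nat \<Rightarrow> 'w \<Rightarrow> real"
  assumes "simple_graph E"
    and "ctmc M (interaction_rate \<alpha> \<beta> E) Y S"
    and "\<alpha> < 0"
    and "\<alpha> + \<beta> * largest_eigenvalue (adjacency_matrix E) = 0"
  shows "transient M (chain_at Y S) \<and> non_explosive M S"
proof -
  obtain v where "norm v = 1" "\<And>i. 0 \<le> v $ i" "interaction_matrix \<alpha> \<beta> E *v v = 0"
    and "0 < \<beta>" and "\<And>x. x \<bullet> (interaction_matrix \<alpha> \<beta> E *v x) \<le> 0"
    using interaction_matrix_degenerate[OF assms(1,3,4)] by blast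
  then show ?thesis
    using assms(1-3) transient_interaction[of E M \<alpha> \<beta> Y S v] non_explosive_interaction[of E M \<alpha> \<beta> Y S]
    by blast
qed

end
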